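(* Let $n \geq 3$. For all smooth functions $f,g$ on $S^{n-1}$, $$ \mathrm{cov}_{\sigma_{n-1}}(f,g) = \int_0^\infty \int_{S^{n-1}} \langle \nabla_S f,\nabla_S P_t g\rangle \, d\sigma_{n-1}\,dt. $$
   Context: $S^{n-1}$ is the Euclidean unit sphere in $\mathbb{R}^n$ and $\sigma_{n-1}$ the uniform probability measure on it. The covariance is $\mathrm{cov}_{\sigma_{n-1}}(f,g) = \int fg\,d\sigma_{n-1} - \int f\,d\sigma_{n-1}\int g\,d\sigma_{n-1}$. "Smooth" means real-valued and $C^1$-smooth. The spherical gradient $\nabla_S f(x) \in \mathbb{R}^n$ is the shortest vector $w \in \mathbb{R}^n$ satisfying $f(x') = f(x) + \langle w, x'-x\rangle + o(|x'-x|)$ as $x' \to x$, $x' \in S^{n-1}$. $P_t = e^{t\Delta_S}$, $t \geq 0$, is the heat semi-group on the sphere, whose generator is the spherical Laplacian (Laplace–Beltrami operator) $\Delta_S$. Explicitly, if $f = \sum_{d=0}^\infty f_d$ is the orthogonal expansion of $f \in L^2(\sigma_{n-1})$ in spherical harmonics ($f_d$ being the restriction to the sphere of a $d$-homogeneous harmonic polynomial, so that $\Delta_S f_d = -d(n+d-2)f_d$), then $P_t f = \sum_{d=0}^\infty e^{-d(n+d-2)t} f_d$; $P_t f$ is $C^\infty$-smooth for $t>0$. *)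

theory Defs
  imports "HOL-Analysis.Analysis"
begin

text \<open>
  Functions on the unit sphere are represented by functions on the ambient Euclidean space
  of which only the values on \<^term>\<open>sphere 0 1\<close> matter.
\<close>

text \<open>
  The uniform probability measure on the unit sphere, as the image of the uniform distribution
  on the unit ball under the radial projection \<open>x \<mapsto> x / |x|\<close>. The centre of the ball, where
  \<^term>\<open>sgn\<close> is 0, is a null set.
\<close>

definition sphere_measure :: "'a::euclidean_space measure" where
  "sphere_measure =
     restrict_space (distr (uniform_measure lborel (ball 0 1)) borel sgn) (sphere 0 1)"

definition covariance :: "'a measure \<Rightarrow> ('a \<Rightarrow> real) \<Rightarrow> ('a \<Rightarrow> real) \<Rightarrow> real" where
  "covariance M f g =
     (LINT x|M. f x * g x) - (LINT x|M. f x) * (LINT x|M. g x)"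

text \<open>
  Being \<open>C\<^sup>1\<close> on the sphere is meant in the sense of submanifolds: near every point of the sphere,
  the function agrees with a \<open>C\<^sup>1\<close> function \<open>F\<close>, with gradient \<open>G\<close>, on an open subset of the
  ambient space.
\<close>

definition C1_on_sphere :: "('a::euclidean_space \<Rightarrow> real) \<Rightarrow> bool" where
  "C1_on_sphere f \<longleftrightarrow>
     (\<forall>x\<in>sphere 0 1. \<exists>U F G. open U \<and> x \<in> U \<and>
        (\<forall>y\<in>U. (F has_derivative (\<lambda>h. G y \<bullet> h)) (at y)) \<and>
        continuous_on U (G :: 'a \<Rightarrow> 'a) \<and>
        (\<forall>y\<in>U \<inter> sphere 0 1. F y = f y))"

text \<open>
  The predicate minimised over is \<open>f x' = f x + w \<bullet> (x' - x) + o(|x' - x|)\<close> as \<open>x' \<rightarrow> x\<close> in the sphere.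
\<close>

definition spherical_gradient :: "('a::euclidean_space \<Rightarrow> real) \<Rightarrow> 'a \<Rightarrow> 'a" where
  "spherical_gradient f x =
     arg_min norm (\<lambda>w. (f has_derivative (\<lambda>h. w \<bullet> h)) (at x within sphere 0 1))"

definition partial_deriv ::
    "'a::euclidean_space \<Rightarrow> ('a \<Rightarrow> real) \<Rightarrow> 'a \<Rightarrow> real" where
  "partial_deriv b f x = deriv (\<lambda>s. f (x + s *\<^sub>R b)) 0"

definition laplacian :: "('a::euclidean_space \<Rightarrow> real) \<Rightarrow> 'a \<Rightarrow> real" where
  "laplacian f x = (\<Sum>b\<in>Basis. partial_deriv b (partial_deriv b f) x)"

text \<open>
  A spherical harmonic of degree \<open>d\<close> is represented by the \<open>d\<close>-homogeneous harmonic polynomial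
  of which it is the restriction. Including \<open>c = 0\<close> in the homogeneity condition excludes nothing,
  since \<open>0 ^ 0 = 1\<close>.
\<close>

definition spherical_harmonics :: "nat \<Rightarrow> ('a::euclidean_space \<Rightarrow> real) set" where
  "spherical_harmonics d =
     {p. real_polynomial_function p \<and>
         (\<forall>c x. p (c *\<^sub>R x) = c ^ d * p x) \<and>
         (\<forall>x. laplacian p x = 0)}"

text \<open>The series converges to \<open>f\<close> in \<open>L\<^sup>2\<close> of the sphere.\<close>

definition is_harmonic_expansion ::
    "('a::euclidean_space \<Rightarrow> real) \<Rightarrow> (nat \<Rightarrow> 'a \<Rightarrow> real) \<Rightarrow> bool" where
  "is_harmonic_expansion f F \<longleftrightarrow>
     (\<forall>d. F d \<in> spherical_harmonics d) \<and>
     (\<lambda>N. \<integral>\<^sup>+ x. ennreal ((f x - (\<Sum>d<N. F d x))\<^sup>2) \<partial>sphere_measure) \<longlonglongrightarrow> 0"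

definition harmonic_component ::
    "('a::euclidean_space \<Rightarrow> real) \<Rightarrow> nat \<Rightarrow> 'a \<Rightarrow> real" where
  "harmonic_component f = (THE F. is_harmonic_expansion f F)"

text \<open>
  The heat semigroup. For \<open>t > 0\<close> the series converges absolutely and uniformly on the sphere, so
  that its pointwise sum is the smooth representative. For \<open>t = 0\<close>, where the operator is the
  identity, the series need not converge pointwise.
\<close>

definition heat_semigroup ::
    "real \<Rightarrow> ('a::euclidean_space \<Rightarrow> real) \<Rightarrow> 'a \<Rightarrow> real" where
  "heat_semigroup t f x =
     (if t = 0 then f x
      else (\<Sum>d. exp (- (real d * (real DIM('a) + real d - 2) * t)) * harmonic_component f d x))"

end

theory Submission
  imports Defs
begin

text \<open>
  Formally the theorem is the fundamental theorem of calculus: the derivative of \<open>\<integral> f P\<^sub>t g\<close> in \<open>t\<close> is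
  \<open>\<integral> f \<Delta>\<^sub>S P\<^sub>t g = - \<integral> \<langle>\<nabla>\<^sub>S f, \<nabla>\<^sub>S P\<^sub>t g\<rangle>\<close>, and \<open>P\<^sub>t g\<close> goes from \<open>g\<close> to its mean. It is proved here term by term
  in the expansion \<open>g = \<Sum> g\<^sub>d\<close> in spherical harmonics. With \<open>\<lambda>\<^sub>d = d (n + d - 2)\<close>, integration by parts gives
  \<open>\<integral> \<langle>\<nabla>\<^sub>S f, \<nabla>\<^sub>S P\<^sub>t g\<rangle> = \<Sum> \<lambda>\<^sub>d exp (- \<lambda>\<^sub>d t) \<integral> f g\<^sub>d\<close>; each term with \<open>d > 0\<close> integrates over \<open>t \<ge> 0\<close> to \<open>\<integral> f g\<^sub>d\<close>,
  and \<open>\<integral> f g\<^sub>0\<close> is the product of the means of \<open>f\<close> and \<open>g\<close>. Sum and integral may be interchanged because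
  \<open>\<Sum> |\<integral> f g\<^sub>d|\<close> converges, by Bessel's inequality (\<open>harmonic_component_abs_summable\<close>).

  Integration by parts uses neither charts nor polar coordinates, only rotation invariance. The derivative of a
  function along the rotations of a coordinate plane has mean zero (\<open>integral_rotation_derivative_zero\<close>); on the
  unit sphere, the scalar product of two spherical gradients is half the sum of the products of these angular
  derivatives \<open>x\<^sub>i \<partial>\<^sub>j - x\<^sub>j \<partial>\<^sub>i\<close> over all \<open>i\<close> and \<open>j\<close>, and half the sum of their squares acts on homogeneous
  polynomials as the spherical Laplacian (\<open>sum_angular_squared\<close>). This yields
  \<open>integral_spherical_gradient_polynomial\<close> and with it the orthogonality of harmonics of different degrees.

  The expansion exists since every polynomial agrees on the sphere with a sum of harmonics
  (\<open>harmonic_decomposition\<close>) and polynomials are uniformly dense; it is unique by orthogonality.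

  Applied to the ball, rotation invariance also gives the mean value property of harmonic polynomials, hence bounds
  for a spherical harmonic and its gradient by its \<open>L\<^sup>2\<close> norm which grow only exponentially in the degree
  (\<open>spherical_harmonic_gradient_bound\<close>). The factors \<open>exp (- \<lambda>\<^sub>d t)\<close> decay faster than any exponential in \<open>d\<close>, so
  that for \<open>t > 0\<close> the heat series can be differentiated termwise (\<open>heat_semigroup_has_derivative\<close>).
\<close>

section \<open>Polynomial functions and their partial derivatives\<close>

lemma partial_deriv_eqI:
  assumes "(p has_derivative (\<lambda>h. G \<bullet> h)) (at x)"
  shows "partial_deriv b p x = G \<bullet> b"
proof -
  have "((\<lambda>s. p (x + s *\<^sub>R b)) has_derivative (\<lambda>s. G \<bullet> (s *\<^sub>R b))) (at 0)"
    by (rule has_derivative_compose[where g = p and f = "\<lambda>s. x + s *\<^sub>R b"])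
       (auto intro!: derivative_eq_intros simp: assms)
  then have "((\<lambda>s. p (x + s *\<^sub>R b)) has_real_derivative (G \<bullet> b)) (at 0)"
    by (simp add: has_field_derivative_def mult.commute[of _ "G \<bullet> b"])
  then show ?thesis
    unfolding partial_deriv_def by (rule DERIV_imp_deriv)
qed

definition gradient :: "('a::euclidean_space \<Rightarrow> real) \<Rightarrow> 'a \<Rightarrow> 'a" where
  "gradient p x = (\<Sum>b\<in>Basis. partial_deriv b p x *\<^sub>R b)"

lemma gradient_inner_Basis: "b \<in> Basis \<Longrightarrow> gradient p x \<bullet> b = partial_deriv b p x"
  unfolding gradient_def by simp

lemma polynomial_gradient_exists:
  fixes p :: "'a::euclidean_space \<Rightarrow> real"
  assumes "real_polynomial_function p"
  shows "\<exists>G. (\<forall>b. real_polynomial_function (\<lambda>x. G x \<bullet> b)) \<and>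
             (\<forall>x. (p has_derivative (\<lambda>h. G x \<bullet> h)) (at x))"
  using assms
proof (induction p rule: real_polynomial_function.induct)
  case (linear f)
  have f_eq: "f h = (\<Sum>b\<in>Basis. f b *\<^sub>R b) \<bullet> h" for h
  proof -
    have "f h = f (\<Sum>b\<in>Basis. (h \<bullet> b) *\<^sub>R b)"
      by (simp add: euclidean_representation)
    also have "\<dots> = (\<Sum>b\<in>Basis. (h \<bullet> b) * f b)"
      using linear by (simp add: bounded_linear.linear linear_sum linear_scale)
    also have "\<dots> = (\<Sum>b\<in>Basis. f b *\<^sub>R b) \<bullet> h"
      by (simp add: inner_commute[of _ h] inner_sum_right mult.commute)
    finally show ?thesis .
  qed
  have "(\<lambda>h. (\<Sum>b\<in>Basis. f b *\<^sub>R b) \<bullet> h) = f"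
    by (rule ext) (rule f_eq[symmetric])
  then have "(f has_derivative (\<lambda>h. (\<Sum>b\<in>Basis. f b *\<^sub>R b) \<bullet> h)) (at x)" for x
    using bounded_linear_imp_has_derivative[OF linear] by simp
  then show ?case
    by (intro exI[where x = "\<lambda>x. \<Sum>b\<in>Basis. f b *\<^sub>R b"]) auto
next
  case (const c)
  show ?case
    by (intro exI[where x = "\<lambda>x. 0"]) (auto intro!: derivative_eq_intros)
next
  case (add f g)
  then obtain F G where "\<forall>b. real_polynomial_function (\<lambda>x. F x \<bullet> b)"
      "\<forall>x. (f has_derivative (\<lambda>h. F x \<bullet> h)) (at x)"
      "\<forall>b. real_polynomial_function (\<lambda>x. G x \<bullet> b)"
      "\<forall>x. (g has_derivative (\<lambda>h. G x \<bullet> h)) (at x)" by blast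
  then show ?case
    by (intro exI[where x = "\<lambda>x. F x + G x"])
       (auto simp: inner_add_left intro!: derivative_eq_intros)
next
  case (mult f g)
  then obtain F G where "\<forall>b. real_polynomial_function (\<lambda>x. F x \<bullet> b)"
      "\<forall>x. (f has_derivative (\<lambda>h. F x \<bullet> h)) (at x)"
      "\<forall>b. real_polynomial_function (\<lambda>x. G x \<bullet> b)"
      "\<forall>x. (g has_derivative (\<lambda>h. G x \<bullet> h)) (at x)" by blast
  with mult.hyps show ?case
    by (intro exI[where x = "\<lambda>x. f x *\<^sub>R G x + g x *\<^sub>R F x"])
       (auto simp: inner_add_left algebra_simps
          intro!: derivative_eq_intros real_polynomial_function.intros(3,4))
qed

lemma polynomial_has_derivative:
  assumes "real_polynomial_function p"
  shows "(p has_derivative (\<lambda>h. gradient p x \<bullet> h)) (at x)"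
proof -
  obtain G where G: "\<forall>x. (p has_derivative (\<lambda>h. G x \<bullet> h)) (at x)"
    using polynomial_gradient_exists[OF assms] by blast
  have "gradient p x = G x"
    by (rule euclidean_eqI) (simp add: gradient_inner_Basis partial_deriv_eqI[OF G[rule_format]])
  with G show ?thesis by simp
qed

lemma partial_deriv_polynomial [intro]:
  assumes "real_polynomial_function p"
  shows "real_polynomial_function (partial_deriv b p)"
proof -
  obtain G where G: "\<forall>x. (p has_derivative (\<lambda>h. G x \<bullet> h)) (at x)"
    "\<forall>b. real_polynomial_function (\<lambda>x. G x \<bullet> b)"
    using polynomial_gradient_exists[OF assms] by blast
  have "partial_deriv b p = (\<lambda>x. G x \<bullet> b)"
    using partial_deriv_eqI[OF G(1)[rule_format]] by auto
  with G show ?thesis by simp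
qed

lemma gradient_inner:
  assumes "real_polynomial_function p"
  shows "gradient p x \<bullet> b = partial_deriv b p x"
  using partial_deriv_eqI[OF polynomial_has_derivative[OF assms]] by simp

lemma polynomial_continuous_on:
  "real_polynomial_function p \<Longrightarrow> continuous_on S p"
  by (simp add: continuous_at_imp_continuous_on continuous_real_polymonial_function)

lemma real_polynomial_inner [intro]: "real_polynomial_function (\<lambda>x. x \<bullet> c)"
  by (intro real_polynomial_function.intros(1) bounded_linear_inner_left)

lemma real_polynomial_inner_self [intro]:
  "real_polynomial_function (\<lambda>x::'a::euclidean_space. x \<bullet> x)"
proof -
  have "(\<lambda>x::'a. x \<bullet> x) = (\<lambda>x. \<Sum>b\<in>Basis. (x \<bullet> b) * (x \<bullet> b))"
    by (rule ext) (rule euclidean_inner)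
  then show ?thesis by (auto intro!: real_polynomial_function_sum)
qed

subsection \<open>Rules of calculus\<close>

lemma partial_deriv_const [simp]: "partial_deriv b (\<lambda>x. c) = (\<lambda>x. 0)"
  by (simp add: partial_deriv_def fun_eq_iff)

lemma partial_deriv_linear: "bounded_linear f \<Longrightarrow> partial_deriv b f = (\<lambda>x. f b)"
  unfolding partial_deriv_def
  by (auto simp: fun_eq_iff bounded_linear.linear linear_add linear_scale intro!: DERIV_imp_deriv derivative_eq_intros)

lemma partial_deriv_inner: "partial_deriv b (\<lambda>x. x \<bullet> c) = (\<lambda>x. b \<bullet> c)"
  by (intro partial_deriv_linear bounded_linear_inner_left)

lemma partial_deriv_add:
  assumes "real_polynomial_function p" "real_polynomial_function q"
  shows "partial_deriv b (\<lambda>x. p x + q x) = (\<lambda>x. partial_deriv b p x + partial_deriv b q x)"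
proof
  fix x
  have "((\<lambda>x. p x + q x) has_derivative (\<lambda>h. (gradient p x + gradient q x) \<bullet> h)) (at x)"
    using assms[THEN polynomial_has_derivative]
    by (auto simp: inner_add_left intro!: derivative_eq_intros)
  from partial_deriv_eqI[OF this]
  show "partial_deriv b (\<lambda>x. p x + q x) x = partial_deriv b p x + partial_deriv b q x"
    by (simp add: inner_add_left assms gradient_inner)
qed

lemma partial_deriv_mult:
  assumes "real_polynomial_function p" "real_polynomial_function q"
  shows "partial_deriv b (\<lambda>x. p x * q x) = (\<lambda>x. partial_deriv b p x * q x + p x * partial_deriv b q x)"
proof
  fix x
  have "((\<lambda>x. p x * q x) has_derivative (\<lambda>h. (q x *\<^sub>R gradient p x + p x *\<^sub>R gradient q x) \<bullet> h)) (at x)"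
    using assms[THEN polynomial_has_derivative]
    by (auto simp: algebra_simps inner_add_left intro!: derivative_eq_intros)
  from partial_deriv_eqI[OF this]
  show "partial_deriv b (\<lambda>x. p x * q x) x = partial_deriv b p x * q x + p x * partial_deriv b q x"
    by (simp add: inner_add_left assms gradient_inner)
qed

lemma partial_deriv_cmult:
  "real_polynomial_function p \<Longrightarrow> partial_deriv b (\<lambda>x. c * p x) = (\<lambda>x. c * partial_deriv b p x)"
  by (subst partial_deriv_mult) auto

lemma partial_deriv_diff:
  assumes "real_polynomial_function p" "real_polynomial_function q"
  shows "partial_deriv b (\<lambda>x. p x - q x) = (\<lambda>x. partial_deriv b p x - partial_deriv b q x)"
  using partial_deriv_add[of p "\<lambda>x. - 1 * q x" b] partial_deriv_cmult[of q b "- 1"] assms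
  by auto

lemma partial_deriv_sum:
  assumes "finite I" "\<And>i. i \<in> I \<Longrightarrow> real_polynomial_function (p i)"
  shows "partial_deriv b (\<lambda>x. \<Sum>i\<in>I. p i x) = (\<lambda>x. \<Sum>i\<in>I. partial_deriv b (p i) x)"
  using assms
proof (induction I rule: finite_induct)
  case (insert i I)
  have "partial_deriv b (\<lambda>x. p i x + (\<Sum>i\<in>I. p i x)) =
      (\<lambda>x. partial_deriv b (p i) x + partial_deriv b (\<lambda>x. \<Sum>i\<in>I. p i x) x)"
    using insert by (intro partial_deriv_add real_polynomial_function_sum) auto
  with insert show ?case by simp
qed simp

lemma partial_deriv_commute:
  assumes "real_polynomial_function p"
  shows "partial_deriv b (partial_deriv c p) = partial_deriv c (partial_deriv b p)"
  using assms
proof (induction p rule: real_polynomial_function.induct)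
  case (linear f)
  then show ?case by (simp add: partial_deriv_linear)
next
  case (add f g)
  then show ?case by (simp add: partial_deriv_add partial_deriv_polynomial)
next
  case (mult f g)
  have "real_polynomial_function (\<lambda>x. partial_deriv b f x * g x)"
    "real_polynomial_function (\<lambda>x. f x * partial_deriv b g x)" for b
    using mult.hyps by (auto intro!: real_polynomial_function.intros(4))
  then show ?case using mult
    by (simp add: partial_deriv_add partial_deriv_mult partial_deriv_polynomial fun_eq_iff)
qed simp

lemma polynomial_gradient_continuous_on:
  assumes "real_polynomial_function p"
  shows "continuous_on S (gradient p)"
  unfolding gradient_def using assms
  by (intro continuous_intros polynomial_continuous_on partial_deriv_polynomial)

lemma laplacian_polynomial [intro]:
  "real_polynomial_function p \<Longrightarrow> real_polynomial_function (laplacian p)"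
  unfolding laplacian_def[abs_def] by (intro real_polynomial_function_sum finite_Basis partial_deriv_polynomial)

lemma laplacian_add:
  assumes "real_polynomial_function p" "real_polynomial_function q"
  shows "laplacian (\<lambda>x. p x + q x) x = laplacian p x + laplacian q x"
  unfolding laplacian_def using assms
  by (simp add: partial_deriv_add partial_deriv_polynomial sum.distrib)

lemma laplacian_diff:
  assumes "real_polynomial_function p" "real_polynomial_function q"
  shows "laplacian (\<lambda>x. p x - q x) x = laplacian p x - laplacian q x"
  unfolding laplacian_def using assms
  by (simp add: partial_deriv_diff partial_deriv_polynomial sum_subtractf)

lemma laplacian_cmult:
  assumes "real_polynomial_function p"
  shows "laplacian (\<lambda>x. c * p x) x = c * laplacian p x"
  unfolding laplacian_def using assms
  by (simp add: partial_deriv_cmult partial_deriv_polynomial sum_distrib_left)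

lemma laplacian_sum:
  assumes "finite I" "\<And>i. i \<in> I \<Longrightarrow> real_polynomial_function (p i)"
  shows "laplacian (\<lambda>x. \<Sum>i\<in>I. p i x) x = (\<Sum>i\<in>I. laplacian (p i) x)"
  unfolding laplacian_def using assms
  by (simp add: partial_deriv_sum partial_deriv_polynomial) (rule sum.swap)

lemma laplacian_mult:
  assumes "real_polynomial_function p" "real_polynomial_function q"
  shows "laplacian (\<lambda>x. p x * q x) x =
    laplacian p x * q x + 2 * (gradient p x \<bullet> gradient q x) + p x * laplacian q x"
proof -
  have pd: "real_polynomial_function (\<lambda>x. partial_deriv b p x * q x)"
     "real_polynomial_function (\<lambda>x. p x * partial_deriv b q x)" for b
    using assms by (auto intro!: real_polynomial_function.intros(4))
  have "gradient p x \<bullet> gradient q x = (\<Sum>b\<in>Basis. partial_deriv b p x * partial_deriv b q x)"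
    by (subst euclidean_inner) (simp add: gradient_inner_Basis)
  then show ?thesis
    unfolding laplacian_def using assms pd
    by (simp add: partial_deriv_mult partial_deriv_add partial_deriv_polynomial sum.distrib
        sum_distrib_left sum_distrib_right algebra_simps)
qed

section \<open>Homogeneous polynomials\<close>

definition homogeneous :: "nat \<Rightarrow> ('a::real_vector \<Rightarrow> real) \<Rightarrow> bool" where
  "homogeneous d p \<longleftrightarrow> (\<forall>c x. p (c *\<^sub>R x) = c ^ d * p x)"

lemma homogeneousD: "homogeneous d p \<Longrightarrow> p (c *\<^sub>R x) = c ^ d * p x"
  unfolding homogeneous_def by blast

lemma spherical_harmonics_iff:
  "p \<in> spherical_harmonics d \<longleftrightarrow>
     real_polynomial_function p \<and> homogeneous d p \<and> (\<forall>x. laplacian p x = 0)"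
  by (simp add: spherical_harmonics_def homogeneous_def)

lemma homogeneous_zero [simp]: "homogeneous d (\<lambda>x. 0)"
  by (simp add: homogeneous_def)

lemma homogeneous_cmult: "homogeneous d p \<Longrightarrow> homogeneous d (\<lambda>x. c * p x)"
  by (simp add: homogeneous_def)

lemma homogeneous_diff:
  "homogeneous d p \<Longrightarrow> homogeneous d q \<Longrightarrow> homogeneous d (\<lambda>x. p x - q x)"
  by (simp add: homogeneous_def algebra_simps)

lemma homogeneous_sum:
  "(\<And>i. i \<in> I \<Longrightarrow> homogeneous d (p i)) \<Longrightarrow> homogeneous d (\<lambda>x. \<Sum>i\<in>I. p i x)"
  by (simp add: homogeneous_def sum_distrib_left)

lemma homogeneous_mult:
  "homogeneous d p \<Longrightarrow> homogeneous e q \<Longrightarrow> homogeneous (d + e) (\<lambda>x. p x * q x)"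
  by (simp add: homogeneous_def power_add algebra_simps)

lemma homogeneous_inner_self_power:
  "homogeneous (2 * j) (\<lambda>x::'a::real_inner. (x \<bullet> x) ^ j)"
  by (simp add: homogeneous_def power_mult power_mult_distrib power2_eq_square mult.assoc)

lemma spherical_harmonics_zero: "(\<lambda>x. 0) \<in> spherical_harmonics d"
  by (auto simp: spherical_harmonics_iff laplacian_def)

lemma spherical_harmonics_cmult:
  "p \<in> spherical_harmonics d \<Longrightarrow> (\<lambda>x. c * p x) \<in> spherical_harmonics d"
  by (auto simp: spherical_harmonics_iff laplacian_cmult homogeneous_cmult
      intro!: real_polynomial_function.intros(4))

lemma spherical_harmonics_add:
  "p \<in> spherical_harmonics d \<Longrightarrow> q \<in> spherical_harmonics d \<Longrightarrow>
     (\<lambda>x. p x + q x) \<in> spherical_harmonics d"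
  by (auto simp: spherical_harmonics_iff laplacian_add homogeneous_def algebra_simps)

lemma spherical_harmonics_diff:
  "p \<in> spherical_harmonics d \<Longrightarrow> q \<in> spherical_harmonics d \<Longrightarrow>
     (\<lambda>x. p x - q x) \<in> spherical_harmonics d"
  by (auto simp: spherical_harmonics_iff laplacian_diff homogeneous_diff)

lemma euler_homogeneous:
  assumes "real_polynomial_function p" "homogeneous d p"
  shows "gradient p x \<bullet> x = d * p x"
proof -
  have "((\<lambda>c. p (c *\<^sub>R x)) has_derivative (\<lambda>c. gradient p x \<bullet> (c *\<^sub>R x))) (at 1)"
    by (rule has_derivative_compose[where g = p and f = "\<lambda>c. c *\<^sub>R x"])
       (auto intro!: derivative_eq_intros polynomial_has_derivative assms)
  then have "((\<lambda>c. p (c *\<^sub>R x)) has_real_derivative (gradient p x \<bullet> x)) (at 1)"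
    by (simp add: has_field_derivative_def mult.commute[of _ "gradient p x \<bullet> x"])
  moreover have "((\<lambda>c. c ^ d * p x) has_real_derivative (d * p x)) (at 1)"
    by (auto intro!: derivative_eq_intros)
  ultimately show ?thesis
    using DERIV_unique homogeneousD[OF assms(2)] by fastforce
qed

text \<open>
  Differentiate \<open>p (c x) = c\<^sup>d p x\<close> in \<open>x\<close> and divide by \<open>c\<close>; the case \<open>c = 0\<close> follows by continuity. For
  \<open>d = 0\<close>, where \<open>d - 1\<close> is truncated to 0, the derivative vanishes.
\<close>

lemma homogeneous_partial_deriv:
  fixes p :: "'a::euclidean_space \<Rightarrow> real"
  assumes p: "real_polynomial_function p" and d: "homogeneous d p"
  shows "homogeneous (d - 1) (partial_deriv b p)"
proof (cases d)
  case 0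
  then have "p x = p 0" for x
    using homogeneousD[OF d, of 0 x] by simp
  then have "p = (\<lambda>x. p 0)" by (rule ext)
  then have "partial_deriv b p = (\<lambda>x. 0)"
    by (metis partial_deriv_const)
  then show ?thesis by simp
next
  case (Suc e)
  have nz: "partial_deriv b p (c *\<^sub>R x) = c ^ e * partial_deriv b p x" if "c \<noteq> 0" for c x
  proof -
    have "((\<lambda>y. p (c *\<^sub>R y)) has_derivative (\<lambda>h. gradient p (c *\<^sub>R x) \<bullet> (c *\<^sub>R h))) (at x)"
      by (rule has_derivative_compose[where g = p and f = "\<lambda>y. c *\<^sub>R y"])
         (auto intro!: derivative_eq_intros polynomial_has_derivative p)
    then have "((\<lambda>y. p (c *\<^sub>R y)) has_derivative (\<lambda>h. (c *\<^sub>R gradient p (c *\<^sub>R x)) \<bullet> h)) (at x)"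
      by simp
    from partial_deriv_eqI[OF this, of b]
    have "partial_deriv b (\<lambda>y. p (c *\<^sub>R y)) x = c * partial_deriv b p (c *\<^sub>R x)"
      by (simp add: gradient_inner p)
    moreover have "partial_deriv b (\<lambda>y. p (c *\<^sub>R y)) x = c ^ Suc e * partial_deriv b p x"
      by (simp add: homogeneousD[OF d] Suc partial_deriv_cmult p del: power_Suc)
    ultimately show ?thesis using that by simp
  qed
  have "partial_deriv b p (0 *\<^sub>R x) = 0 ^ e * partial_deriv b p x" for x
  proof -
    have "isCont (partial_deriv b p) (0 *\<^sub>R x)"
      by (intro continuous_real_polymonial_function partial_deriv_polynomial p)
    then have "((\<lambda>c. partial_deriv b p (c *\<^sub>R x)) \<longlongrightarrow> partial_deriv b p (0 *\<^sub>R x)) (at 0)"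
      by (rule isCont_tendsto_compose) (intro tendsto_intros)
    moreover have "((\<lambda>c. partial_deriv b p (c *\<^sub>R x)) \<longlongrightarrow> 0 ^ e * partial_deriv b p x) (at 0)"
    proof (rule Lim_transform_eventually)
      show "((\<lambda>c. c ^ e * partial_deriv b p x) \<longlongrightarrow> 0 ^ e * partial_deriv b p x) (at 0)"
        by (intro tendsto_intros)
      show "\<forall>\<^sub>F c in at 0. c ^ e * partial_deriv b p x = partial_deriv b p (c *\<^sub>R x)"
        using nz by (auto simp: eventually_at_filter)
    qed
    ultimately show ?thesis
      using LIM_unique by blast
  qed
  with nz Suc show ?thesis
    unfolding homogeneous_def by (metis diff_Suc_1)
qed

lemma homogeneous_laplacian:
  assumes "real_polynomial_function p" "homogeneous d p"
  shows "homogeneous (d - 2) (laplacian p)"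
  unfolding laplacian_def[abs_def]
proof (rule homogeneous_sum)
  fix b :: 'a
  show "homogeneous (d - 2) (partial_deriv b (partial_deriv b p))"
    using homogeneous_partial_deriv[OF partial_deriv_polynomial homogeneous_partial_deriv, OF assms(1) assms, of b b]
    by (simp add: numeral_2_eq_2)
qed

lemma laplacian_low_degree:
  assumes p: "real_polynomial_function p" and d: "homogeneous d p" and "d < 2"
  shows "laplacian p x = 0"
proof -
  have "partial_deriv b (partial_deriv b p) x = 0" for b
  proof -
    have "homogeneous 0 (partial_deriv b p)"
      using homogeneous_partial_deriv[OF p d, of b] \<open>d < 2\<close> by (simp add: numeral_2_eq_2 less_Suc_eq_le)
    then have "partial_deriv b p x = partial_deriv b p 0" for x
      using homogeneousD[of 0 "partial_deriv b p" 0 x] by simp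
    then have "partial_deriv b p = (\<lambda>x. partial_deriv b p 0)" by (rule ext)
    then show ?thesis by (metis partial_deriv_const)
  qed
  then show ?thesis by (simp add: laplacian_def)
qed

subsection \<open>The angular derivatives and the spherical Laplacian\<close>

text \<open>
  The infinitesimal rotation of the plane spanned by \<open>i\<close> and \<open>j\<close>, as a differential operator.
\<close>

definition angular :: "'a \<Rightarrow> 'a \<Rightarrow> ('a::euclidean_space \<Rightarrow> real) \<Rightarrow> 'a \<Rightarrow> real" where
  "angular i j p x = (x \<bullet> i) * partial_deriv j p x - (x \<bullet> j) * partial_deriv i p x"

lemma angular_polynomial [intro]:
  "real_polynomial_function p \<Longrightarrow> real_polynomial_function (angular i j p)"
  unfolding angular_def[abs_def]
  by (intro real_polynomial_function_diff real_polynomial_function.intros(4)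
      real_polynomial_inner partial_deriv_polynomial)

text \<open>
  In the expansion of the squares, the second derivatives either assemble to \<open>|x|\<^sup>2 \<Delta>u\<close> or occur in
  \<open>\<Sum> x\<^sub>i x\<^sub>j \<partial>\<^sub>i \<partial>\<^sub>j u\<close>, to which Euler's identity applies twice.
\<close>

lemma sum_angular_squared:
  fixes u :: "'a::euclidean_space \<Rightarrow> real"
  assumes u: "real_polynomial_function u" and k: "homogeneous k u"
  shows "(\<Sum>i\<in>Basis. \<Sum>j\<in>Basis. angular i j (angular i j u) x) =
    2 * ((x \<bullet> x) * laplacian u x - real k * (real k + real DIM('a) - 2) * u x)"
proof -
  define U where "U i j = partial_deriv i (partial_deriv j u) x" for i j
  have ang: "partial_deriv b (angular i j u) x =
      (b \<bullet> i) * partial_deriv j u x + (x \<bullet> i) * U b j -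
      ((b \<bullet> j) * partial_deriv i u x + (x \<bullet> j) * U b i)" for b i j
  proof -
    have *: "real_polynomial_function (\<lambda>x. (x \<bullet> i) * partial_deriv j u x)" for i j
      by (intro real_polynomial_function.intros(4) real_polynomial_inner partial_deriv_polynomial u)
    show ?thesis
      unfolding angular_def[abs_def] U_def
      by (simp add: partial_deriv_diff * partial_deriv_mult real_polynomial_inner partial_deriv_inner
          partial_deriv_polynomial u)
  qed
  have E: "(\<Sum>i\<in>Basis. (x \<bullet> i) * partial_deriv i u x) = k * u x"
    unfolding euler_homogeneous[OF u k, symmetric]
    by (subst euclidean_inner) (simp add: gradient_inner_Basis mult.commute)
  have "(\<Sum>i\<in>Basis. (x \<bullet> i) * U i j) = real (k - 1) * partial_deriv j u x" for j
    unfolding euler_homogeneous[OF partial_deriv_polynomial homogeneous_partial_deriv, OF u u k, symmetric] U_def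
    by (subst euclidean_inner) (simp add: gradient_inner_Basis mult.commute)
  then have "(\<Sum>j\<in>Basis. (x \<bullet> j) * (\<Sum>i\<in>Basis. (x \<bullet> i) * U i j)) = real (k - 1) * (k * u x)"
    by (simp add: E[symmetric] sum_distrib_left mult.left_commute)
  then have S: "(\<Sum>j\<in>Basis. \<Sum>i\<in>Basis. (x \<bullet> j) * ((x \<bullet> i) * U i j)) = real k * (real k - 1) * u x"
    by (cases k) (simp_all add: sum_distrib_left)
  then have S': "(\<Sum>j\<in>Basis. \<Sum>i\<in>Basis. (x \<bullet> i) * ((x \<bullet> j) * U i j)) = real k * (real k - 1) * u x"
    by (simp add: mult.left_commute)
  have "(\<Sum>i\<in>Basis. \<Sum>j\<in>Basis. (x \<bullet> i) * ((x \<bullet> j) * U i j)) = real k * (real k - 1) * u x"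
    by (subst sum.swap) (rule S')
  then have S2: "(\<Sum>i\<in>Basis. (x \<bullet> i) * (\<Sum>j\<in>Basis. (x \<bullet> j) * U i j)) = real k * (real k - 1) * u x"
    by (simp add: sum_distrib_left)
  have U_comm: "U i j = U j i" for i j
    unfolding U_def using partial_deriv_commute[OF u] by metis
  have lap: "(\<Sum>j\<in>Basis. U j j) = laplacian u x"
    unfolding U_def laplacian_def by simp
  have sq: "(\<Sum>j\<in>Basis. (x \<bullet> j) * (x \<bullet> j)) = x \<bullet> x"
    by (rule euclidean_inner[symmetric])
  have term_eq: "angular i j (angular i j u) x =
      (j \<bullet> i) * ((x \<bullet> i) * partial_deriv j u x) + (i \<bullet> j) * ((x \<bullet> j) * partial_deriv i u x)
      + ((x \<bullet> i) * (x \<bullet> i)) * U j j + U i i * ((x \<bullet> j) * (x \<bullet> j))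
      - (x \<bullet> i) * partial_deriv i u x - (x \<bullet> j) * partial_deriv j u x
      - 2 * ((x \<bullet> i) * ((x \<bullet> j) * U i j))"
    if "i \<in> Basis" "j \<in> Basis" for i j
    unfolding angular_def[of i j "angular i j u"] ang using that U_comm[of j i]
    by (simp add: algebra_simps)
  have delta: "(\<Sum>i\<in>Basis. \<Sum>j\<in>Basis. (j \<bullet> i) * ((x \<bullet> i) * partial_deriv j u x)) = k * u x"
    "(\<Sum>i\<in>Basis. \<Sum>j\<in>Basis. (i \<bullet> j) * ((x \<bullet> j) * partial_deriv i u x)) = k * u x"
    unfolding E[symmetric]
    by (auto intro!: sum.cong simp: inner_Basis if_distrib[of "\<lambda>a. a * _"] cong: if_cong)
  have "(\<Sum>i\<in>Basis. \<Sum>j\<in>Basis. angular i j (angular i j u) x) =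
      k * u x + k * u x + (x \<bullet> x) * laplacian u x + laplacian u x * (x \<bullet> x)
      - DIM('a) * (k * u x) - DIM('a) * (k * u x) - 2 * (real k * (real k - 1) * u x)"
    using term_eq
    by (simp add: sum.distrib sum_subtractf delta sum_distrib_left[symmetric]
        sum_distrib_right[symmetric] lap sq E S2)
  then show ?thesis by (simp add: algebra_simps)
qed

text \<open>
  The entries \<open>x\<^sub>i a\<^sub>j - x\<^sub>j a\<^sub>i\<close> are the components of \<open>x \<and> a\<close>: this is Lagrange's identity.
\<close>

lemma lagrange_identity:
  fixes x a b :: "'a::euclidean_space"
  shows "(\<Sum>i\<in>Basis. \<Sum>j\<in>Basis. ((x \<bullet> i) * (a \<bullet> j) - (x \<bullet> j) * (a \<bullet> i)) *
      ((x \<bullet> i) * (b \<bullet> j) - (x \<bullet> j) * (b \<bullet> i))) =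
    2 * ((x \<bullet> x) * (a \<bullet> b) - (x \<bullet> a) * (x \<bullet> b))"
proof -
  have inner: "(\<Sum>i\<in>Basis. (u \<bullet> i) * (v \<bullet> i)) = u \<bullet> v" for u v :: 'a
    by (rule euclidean_inner[symmetric])
  have "(\<Sum>i\<in>Basis. \<Sum>j\<in>Basis. ((x \<bullet> i) * (a \<bullet> j) - (x \<bullet> j) * (a \<bullet> i)) *
      ((x \<bullet> i) * (b \<bullet> j) - (x \<bullet> j) * (b \<bullet> i))) =
    (\<Sum>i\<in>Basis. \<Sum>j\<in>Basis.
       ((x \<bullet> i) * (x \<bullet> i)) * ((a \<bullet> j) * (b \<bullet> j)) + ((a \<bullet> i) * (b \<bullet> i)) * ((x \<bullet> j) * (x \<bullet> j))
     - ((x \<bullet> i) * (b \<bullet> i)) * ((x \<bullet> j) * (a \<bullet> j)) - ((x \<bullet> i) * (a \<bullet> i)) * ((x \<bullet> j) * (b \<bullet> j)))"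
    by (intro sum.cong refl) (simp add: algebra_simps)
  also have "\<dots> = 2 * ((x \<bullet> x) * (a \<bullet> b) - (x \<bullet> a) * (x \<bullet> b))"
    by (simp add: sum.distrib sum_subtractf sum_distrib_left[symmetric]
        sum_distrib_right[symmetric] inner)
  finally show ?thesis .
qed

subsection \<open>Decomposition into spherical harmonics\<close>

lemma gradient_inner_self: "gradient (\<lambda>x::'a::euclidean_space. x \<bullet> x) x = 2 *\<^sub>R x"
proof (rule euclidean_eqI)
  fix b :: 'a
  assume "b \<in> Basis"
  have "((\<lambda>x::'a. x \<bullet> x) has_derivative (\<lambda>h. (2 *\<^sub>R x) \<bullet> h)) (at x)"
    by (auto intro!: derivative_eq_intros simp: inner_commute)
  from partial_deriv_eqI[OF this] show "gradient (\<lambda>x. x \<bullet> x) x \<bullet> b = 2 *\<^sub>R x \<bullet> b"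
    by (simp add: gradient_inner real_polynomial_inner_self)
qed

lemma laplacian_inner_self: "laplacian (\<lambda>x::'a::euclidean_space. x \<bullet> x) x = 2 * real DIM('a)"
proof -
  have "partial_deriv b (\<lambda>x. x \<bullet> x) = (\<lambda>x. 2 * (x \<bullet> b))" for b :: 'a
    by (rule ext) (metis gradient_inner gradient_inner_self inner_scaleR_left real_polynomial_inner_self)
  then show ?thesis
    by (simp add: laplacian_def partial_deriv_cmult real_polynomial_inner partial_deriv_inner)
qed

lemma laplacian_inner_self_mult:
  fixes p :: "'a::euclidean_space \<Rightarrow> real"
  assumes "real_polynomial_function p" "homogeneous k p"
  shows "laplacian (\<lambda>x. (x \<bullet> x) * p x) x =
    (2 * real DIM('a) + 4 * real k) * p x + (x \<bullet> x) * laplacian p x"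
  using assms euler_homogeneous[OF assms, of x]
  by (simp add: laplacian_mult real_polynomial_inner_self laplacian_inner_self gradient_inner_self
      algebra_simps inner_commute)

text \<open>
  Each factor \<open>|x|\<^sup>2\<close> contributes by the previous lemma, and the contributions add up to a nonzero constant.
\<close>

lemma laplacian_power_mult_harmonic:
  fixes w :: "'a::euclidean_space \<Rightarrow> real"
  assumes w: "w \<in> spherical_harmonics k"
  shows "laplacian (\<lambda>x. (x \<bullet> x) ^ Suc j * w x) x =
    2 * (real j + 1) * (real DIM('a) + 2 * real k + 2 * real j) * ((x \<bullet> x) ^ j * w x)"
proof (induction j)
  case 0
  show ?case
    using w laplacian_inner_self_mult[of w k x] by (simp add: spherical_harmonics_iff)
next
  case (Suc j)
  have "real_polynomial_function (\<lambda>x. (x \<bullet> x) ^ Suc j * w x)"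
    using w unfolding spherical_harmonics_iff
    by (intro real_polynomial_function.intros(4) real_polynomial_function_power real_polynomial_inner_self) auto
  moreover have "homogeneous (2 * Suc j + k) (\<lambda>x. (x \<bullet> x) ^ Suc j * w x)"
    using w unfolding spherical_harmonics_iff
    by (intro homogeneous_mult homogeneous_inner_self_power) auto
  ultimately have "laplacian (\<lambda>x. (x \<bullet> x) * ((x \<bullet> x) ^ Suc j * w x)) x =
      (2 * real DIM('a) + 4 * real (2 * Suc j + k)) * ((x \<bullet> x) ^ Suc j * w x) +
      (x \<bullet> x) * laplacian (\<lambda>x. (x \<bullet> x) ^ Suc j * w x) x"
    by (rule laplacian_inner_self_mult)
  then show ?case
    unfolding Suc.IH by (simp add: algebra_simps)
qed

text \<open>
  By induction on the degree, \<open>\<Delta>p\<close> has such a decomposition, and each of its terms is the Laplacian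
  of an explicit multiple of the same harmonic polynomial; what remains of \<open>p\<close> is harmonic.
\<close>

lemma harmonic_decomposition:
  fixes p :: "'a::euclidean_space \<Rightarrow> real"
  assumes "real_polynomial_function p" "homogeneous d p"
  shows "\<exists>w. (\<forall>j. w j \<in> spherical_harmonics (d - 2 * j)) \<and>
             p = (\<lambda>x. \<Sum>j\<le>d div 2. (x \<bullet> x) ^ j * w j x)"
  using assms
proof (induction d arbitrary: p rule: less_induct)
  case (less d)
  show ?case
  proof (cases "d < 2")
    case True
    then have "p \<in> spherical_harmonics d"
      using less.prems laplacian_low_degree by (auto simp: spherical_harmonics_iff)
    then show ?thesis
      using True
      by (intro exI[where x = "\<lambda>j. if j = 0 then p else (\<lambda>x. 0)"]) (auto simp: spherical_harmonics_zero)
  next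
    case False
    define e where "e = d - 2"
    have d: "d = e + 2" using False e_def by simp
    obtain w where w: "\<And>j. w j \<in> spherical_harmonics (e - 2 * j)"
      and lap: "laplacian p = (\<lambda>x. \<Sum>j\<le>e div 2. (x \<bullet> x) ^ j * w j x)"
      using less.IH[of e "laplacian p"] less.prems homogeneous_laplacian[of p d] d by auto
    define C where "C j = 2 * (real j + 1) * (real DIM('a) + 2 * real (e - 2 * j) + 2 * real j)" for j
    have C: "C j > 0" for j
      unfolding C_def by (simp add: add_pos_nonneg)
    define v where "v j = (\<lambda>x. (1 / C j) * w j x)" for j
    have v: "v j \<in> spherical_harmonics (e - 2 * j)" for j
      unfolding v_def by (intro spherical_harmonics_cmult w)
    define q where "q = (\<lambda>j x. (x \<bullet> x) ^ Suc j * v j x)"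
    have q_poly: "real_polynomial_function (q j)" for j
      using v[of j] unfolding spherical_harmonics_iff q_def
      by (intro real_polynomial_function.intros(4) real_polynomial_function_power real_polynomial_inner_self) auto
    have q_hom: "homogeneous d (q j)" if "j \<le> e div 2" for j
    proof -
      have "homogeneous (2 * Suc j + (e - 2 * j)) (q j)"
        using v[of j] unfolding spherical_harmonics_iff q_def
        by (intro homogeneous_mult homogeneous_inner_self_power) auto
      moreover have "2 * Suc j + (e - 2 * j) = d" using that d by auto
      ultimately show ?thesis by metis
    qed
    have q_lap: "laplacian (q j) x = (x \<bullet> x) ^ j * w j x" for j x
      using laplacian_power_mult_harmonic[OF v, of j j x] C[of j]
      unfolding q_def C_def[symmetric] by (simp add: v_def)
    define h where "h = (\<lambda>x. p x - (\<Sum>j\<le>e div 2. q j x))"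
    have "h \<in> spherical_harmonics d"
      unfolding spherical_harmonics_iff
    proof (intro conjI allI)
      show "real_polynomial_function h"
        unfolding h_def by (intro real_polynomial_function_diff real_polynomial_function_sum less.prems q_poly) auto
      show "homogeneous d h"
        unfolding h_def by (intro homogeneous_diff homogeneous_sum less.prems q_hom) auto
      show "laplacian h x = 0" for x
      proof -
        have "laplacian h x = laplacian p x - (\<Sum>j\<le>e div 2. laplacian (q j) x)"
          unfolding h_def
          by (simp add: laplacian_diff real_polynomial_function_sum less.prems(1) q_poly laplacian_sum)
        then show ?thesis
          by (simp add: lap q_lap)
      qed
    qed
    with v d have "case_nat h v j \<in> spherical_harmonics (d - 2 * j)" for j
      by (cases j) auto
    moreover have "p = (\<lambda>x. \<Sum>j\<le>d div 2. (x \<bullet> x) ^ j * case_nat h v j x)"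
      unfolding d by (simp add: sum.atMost_Suc_shift fun_eq_iff h_def q_def del: sum.atMost_Suc)
    ultimately show ?thesis by blast
  qed
qed

subsection \<open>Homogeneous components\<close>

text \<open>
  Monomials are words in the basis vectors, so that a product of monomials is a concatenation.
\<close>

definition monomial :: "'a::euclidean_space list \<Rightarrow> 'a \<Rightarrow> real" where
  "monomial l x = (\<Prod>b\<leftarrow>l. x \<bullet> b)"

lemma monomial_simps [simp]:
  "monomial [] x = 1" "monomial (b # l) x = (x \<bullet> b) * monomial l x"
  "monomial (l @ m) x = monomial l x * monomial m x"
  by (simp_all add: monomial_def)

lemma monomial_polynomial: "real_polynomial_function (monomial l)"
proof (induction l)
  case (Cons b l)
  then show ?case
    unfolding monomial_simps(2)[abs_def] by (intro real_polynomial_function.intros(4) real_polynomial_inner)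
qed (simp add: real_polynomial_function.intros(2) monomial_def)

lemma homogeneous_monomial: "homogeneous (length l) (monomial l)"
  unfolding homogeneous_def by (induction l) (auto simp: algebra_simps)

definition monomial_combination :: "(real \<times> 'a::euclidean_space list) list \<Rightarrow> 'a \<Rightarrow> real" where
  "monomial_combination ts x = (\<Sum>(a, l)\<leftarrow>ts. a * monomial l x)"

lemma monomial_combination_simps [simp]:
  "monomial_combination [] x = 0"
  "monomial_combination ((a, l) # ts) x = a * monomial l x + monomial_combination ts x"
  "monomial_combination (ts @ us) x = monomial_combination ts x + monomial_combination us x"
  by (simp_all add: monomial_combination_def)

lemma monomial_combination_polynomial: "real_polynomial_function (monomial_combination ts)"
proof (induction ts)
  case (Cons t ts)
  obtain a l where t: "t = (a, l)" by fastforce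
  show ?case
    unfolding t monomial_combination_simps(2)[abs_def]
    by (intro real_polynomial_function.intros(2-4) monomial_polynomial Cons)
qed (simp add: real_polynomial_function.intros(2) monomial_combination_def)

lemma homogeneous_monomial_combination:
  "(\<And>t. t \<in> set ts \<Longrightarrow> length (snd t) = d) \<Longrightarrow> homogeneous d (monomial_combination ts)"
proof (induction ts)
  case (Cons t ts)
  then have "length (snd t) = d" "homogeneous d (monomial_combination ts)" by auto
  moreover have "homogeneous (length (snd t)) (monomial (snd t))" by (rule homogeneous_monomial)
  ultimately show ?case
    by (cases t) (simp add: homogeneous_def algebra_simps)
qed (simp add: homogeneous_def)

lemma polynomial_monomial_combination:
  fixes p :: "'a::euclidean_space \<Rightarrow> real"
  assumes "real_polynomial_function p"
  shows "\<exists>ts. (\<forall>t\<in>set ts. set (snd t) \<subseteq> Basis) \<and> p = monomial_combination ts"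
  using assms
proof (induction p rule: real_polynomial_function.induct)
  case (linear f)
  obtain bs where bs: "set bs = (Basis :: 'a set)" "distinct bs"
    using finite_distinct_list[OF finite_Basis] by blast
  have "f x = monomial_combination (map (\<lambda>b. (f b, [b])) bs) x" for x
  proof -
    have "f x = f (\<Sum>b\<in>Basis. (x \<bullet> b) *\<^sub>R b)"
      by (simp add: euclidean_representation)
    also have "\<dots> = (\<Sum>b\<in>Basis. f b * (x \<bullet> b))"
      using linear by (simp add: bounded_linear.linear linear_sum linear_scale mult.commute)
    also have "\<dots> = (\<Sum>b\<leftarrow>bs. f b * (x \<bullet> b))"
      using bs by (simp add: sum_list_distinct_conv_sum_set)
    finally show ?thesis by (simp add: monomial_combination_def o_def)
  qed
  then have "f = monomial_combination (map (\<lambda>b. (f b, [b])) bs)" by (rule ext)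
  with bs show ?case by (intro exI[where x = "map (\<lambda>b. (f b, [b])) bs"]) auto
next
  case (const c)
  show ?case by (intro exI[where x = "[(c, [])]"]) auto
next
  case (add f g)
  then obtain ts us where "\<forall>t\<in>set ts. set (snd t) \<subseteq> Basis" "f = monomial_combination ts"
    "\<forall>t\<in>set us. set (snd t) \<subseteq> Basis" "g = monomial_combination us" by blast
  then show ?case by (intro exI[where x = "ts @ us"]) auto
next
  case (mult f g)
  then obtain ts us where *: "\<forall>t\<in>set ts. set (snd t) \<subseteq> Basis" "f = monomial_combination ts"
    "\<forall>t\<in>set us. set (snd t) \<subseteq> Basis" "g = monomial_combination us" by blast
  define vs where "vs = concat (map (\<lambda>(a, l). map (\<lambda>(b, m). (a * b, l @ m)) us) ts)"
  have scale: "monomial_combination (map (\<lambda>(b, m). (a * b, l @ m)) us) x =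
      a * monomial l x * monomial_combination us x" for a l x
    by (induction us) (auto simp: algebra_simps)
  have "monomial_combination vs x = monomial_combination ts x * monomial_combination us x" for x
    unfolding vs_def by (induction ts) (auto simp: scale algebra_simps)
  moreover have "\<forall>t\<in>set vs. set (snd t) \<subseteq> Basis"
    using * unfolding vs_def by fastforce
  ultimately show ?case
    using * by (intro exI[where x = vs]) (auto simp: fun_eq_iff)
qed

text \<open>
  Along a ray, the components are the coefficients of a polynomial in the scaling factor.
\<close>

lemma homogeneous_components_zero:
  assumes "\<And>k. k \<le> D \<Longrightarrow> homogeneous k (P k)" and "\<And>x. (\<Sum>k\<le>D. P k x) = (0::real)" and "k \<le> D"
  shows "P k x = 0"
proof -
  have "(\<Sum>k\<le>D. P k x * c ^ k) = 0" for c
    using assms(2)[of "c *\<^sub>R x"] assms(1) by (simp add: homogeneous_def mult.commute)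
  then show ?thesis
    using zero_polynom_imp_zero_coeffs[where n = D and c = "\<lambda>k. P k x"] assms(3) by auto
qed

lemma monomial_combination_components:
  assumes "\<And>t. t \<in> set ts \<Longrightarrow> length (snd t) \<le> D"
  shows "monomial_combination ts x =
    (\<Sum>k\<le>D. monomial_combination (filter (\<lambda>t. length (snd t) = k) ts) x)"
  using assms
proof (induction ts)
  case (Cons t ts)
  obtain a l where t: "t = (a, l)" by fastforce
  have "monomial_combination (filter (\<lambda>t. length (snd t) = k) (t # ts)) x =
      (if k = length l then a * monomial l x else 0) +
      monomial_combination (filter (\<lambda>t. length (snd t) = k) ts) x" for k
    by (auto simp: t)
  moreover have "length l \<le> D"
    using Cons.prems[of t] t by simp
  ultimately show ?case
    using Cons t by (simp add: sum.distrib)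
qed simp

lemma polynomial_homogeneous_components:
  fixes p :: "'a::euclidean_space \<Rightarrow> real"
  assumes "real_polynomial_function p"
  obtains P D where "\<And>k. real_polynomial_function (P k)" "\<And>k. homogeneous k (P k)"
    "p = (\<lambda>x. \<Sum>k\<le>D. P k x)"
proof -
  obtain ts where ts: "p = monomial_combination ts"
    using polynomial_monomial_combination[OF assms] by blast
  define D where "D = Max (insert 0 ((\<lambda>t. length (snd t)) ` set ts))"
  define P where "P k = monomial_combination (filter (\<lambda>t. length (snd t) = k) ts)" for k
  have "p = (\<lambda>x. \<Sum>k\<le>D. P k x)"
    unfolding P_def ts D_def by (rule ext, rule monomial_combination_components) auto
  then show thesis
    by (rule that[rotated 2]) (auto simp: P_def intro!: monomial_combination_polynomial homogeneous_monomial_combination)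
qed

text \<open>
  The components of the other degrees vanish, and may be dropped from any representation of \<open>p\<close>.
\<close>

lemma homogeneous_polynomial_monomials:
  fixes p :: "'a::euclidean_space \<Rightarrow> real"
  assumes "real_polynomial_function p" and hom: "homogeneous d p"
  obtains ts where "\<And>t. t \<in> set ts \<Longrightarrow> set (snd t) \<subseteq> Basis \<and> length (snd t) = d"
    "p = monomial_combination ts"
proof -
  obtain ts where basis: "\<forall>t\<in>set ts. set (snd t) \<subseteq> Basis" and ts: "p = monomial_combination ts"
    using polynomial_monomial_combination[OF assms(1)] by blast
  define D where "D = Max (insert d ((\<lambda>t. length (snd t)) ` set ts))"
  have D: "d \<le> D" "\<And>t. t \<in> set ts \<Longrightarrow> length (snd t) \<le> D"
    unfolding D_def by auto
  define P where "P k = monomial_combination (filter (\<lambda>t. length (snd t) = k) ts)" for k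
  define Q where "Q k x = P k x - (if k = d then p x else 0)" for k x
  have "P d x - p x = 0" for x
  proof -
    have "Q d x = 0"
    proof (rule homogeneous_components_zero[where P = Q, OF _ _ D(1)])
      show "homogeneous k (Q k)" for k
        unfolding Q_def P_def using hom
        by (cases "k = d") (auto intro!: homogeneous_diff homogeneous_monomial_combination)
      show "(\<Sum>k\<le>D. Q k x) = 0" for x
        using monomial_combination_components[of ts D x] D
        by (simp add: Q_def P_def sum_subtractf ts)
    qed
    then show ?thesis by (simp add: Q_def)
  qed
  then have "p = P d" by (simp add: fun_eq_iff)
  with basis show thesis
    by (intro that[of "filter (\<lambda>t. length (snd t) = d) ts"]) (auto simp: P_def)
qed

text \<open>
  The Laplacian lowers all degrees by 2, so that the Laplacians of the components vanish separately.
\<close>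

lemma harmonic_homogeneous_components:
  fixes p :: "'a::euclidean_space \<Rightarrow> real"
  assumes p: "real_polynomial_function p" and "\<And>x. laplacian p x = 0"
  obtains P D where "\<And>k. P k \<in> spherical_harmonics k" "p = (\<lambda>x. \<Sum>k\<le>D. P k x)"
proof -
  obtain D P where P: "\<And>k. real_polynomial_function (P k)" "\<And>k. homogeneous k (P k)"
    and sum: "p = (\<lambda>x. \<Sum>k\<le>D. P k x)"
    using polynomial_homogeneous_components[OF p] by metis
  have lap0: "laplacian (P k) x = 0" if "k < 2" for k x
    using P that by (intro laplacian_low_degree)
  define Q where "Q k = laplacian (P (k + 2))" for k
  have "(\<Sum>k\<le>D. laplacian (P k) x) = 0" for x
    using assms(2)[of x] P unfolding sum by (simp add: laplacian_sum)
  have split: "(\<Sum>k\<le>D. laplacian (P k) x) = (\<Sum>k\<le>D - 2. Q k x)" if "2 \<le> D" for x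
  proof -
    have "(\<Sum>k\<le>D. laplacian (P k) x) = (\<Sum>k\<in>{2..D}. laplacian (P k) x)"
      using lap0 by (intro sum.mono_neutral_right) auto
    also have "\<dots> = (\<Sum>k\<le>D - 2. Q k x)"
      unfolding Q_def using that
      by (intro sum.reindex_bij_witness[of _ "\<lambda>k. k + 2" "\<lambda>k. k - 2"]) (auto simp del: add_2_eq_Suc')
    finally show ?thesis .
  qed
  have "laplacian (P k) x = 0" if "k \<le> D" for k x
  proof (cases "k < 2")
    case False
    have "Q (k - 2) x = 0"
    proof (rule homogeneous_components_zero[where P = Q and D = "D - 2"])
      show "homogeneous k (Q k)" for k
        unfolding Q_def using homogeneous_laplacian[OF P(1) P(2), of "k + 2"] by simp
      show "(\<Sum>k\<le>D - 2. Q k x) = 0" for x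
        using split that False \<open>\<And>x. (\<Sum>k\<le>D. laplacian (P k) x) = 0\<close> by simp
    qed (use that in simp)
    moreover have "k - 2 + 2 = k" using False by simp
    ultimately show ?thesis unfolding Q_def by simp
  qed (rule lap0)
  then show thesis
    using P sum
    by (intro that[of "\<lambda>k. if k \<le> D then P k else (\<lambda>x. 0)" D])
       (use spherical_harmonics_zero in \<open>auto simp: spherical_harmonics_iff\<close>)
qed

section \<open>Rotations\<close>

lemma orthogonal_transformation_measurable:
  "orthogonal_transformation R \<Longrightarrow> R \<in> borel_measurable (borel :: 'a::euclidean_space measure)"
  by (intro borel_measurable_continuous_onI linear_continuous_on linear_conv_bounded_linear[THEN iffD1]
      orthogonal_transformation_linear)

text \<open>
  Both the Lebesgue measure and its image are translation invariant, and they agree on the unit ball \<open>B\<close>.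
  Translation invariant measures are determined by one such value: Fubini's theorem applied to
  \<open>1\<^sub>A (R x + y) 1\<^sub>B y\<close> gives \<open>|R -` A| |B|\<close> in one order of integration and \<open>|A| |B|\<close> in the other.
\<close>

lemma lborel_distr_orthogonal:
  fixes R :: "'a::euclidean_space \<Rightarrow> 'a"
  assumes R: "orthogonal_transformation R"
  shows "distr lborel borel R = (lborel :: 'a measure)"
proof (rule measure_eqI)
  note [measurable] = orthogonal_transformation_measurable[OF R]
  have lin: "linear R" and norm: "norm (R x) = norm x" for x
    using R by (simp_all add: orthogonal_transformation_linear orthogonal_transformation_norm)
  define S where "S = inv R"
  have RS: "R (S x) = x" for x
    unfolding S_def using orthogonal_transformation_surj[OF R] by (simp add: surj_f_inv_f)
  have shift: "(\<integral>\<^sup>+x. h (c + x) \<partial>lborel) = (\<integral>\<^sup>+x. h x \<partial>lborel)"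
    if [measurable]: "h \<in> borel_measurable borel" for h and c :: 'a
    by (subst (2) lborel_distr_plus[symmetric, of c], subst nn_integral_distr) auto
  let ?B = "ball (0::'a) 1"
  fix A :: "'a set"
  assume "A \<in> sets (distr lborel borel R)"
  then have [measurable]: "A \<in> sets borel" by simp
  have [measurable]: "R -` A \<in> sets borel"
    using measurable_sets_borel[OF orthogonal_transformation_measurable[OF R] \<open>A \<in> sets borel\<close>] .
  have [measurable]: "?B \<in> sets borel" by simp
  have "emeasure lborel (R -` A) * emeasure lborel ?B =
      (\<integral>\<^sup>+y. (\<integral>\<^sup>+x. indicator A (R x) \<partial>lborel) * indicator ?B y \<partial>lborel)"
    by (subst nn_integral_cmult) (auto simp flip: indicator_vimage)
  also have "\<dots> = (\<integral>\<^sup>+y. (\<integral>\<^sup>+x. indicator A (R x + y) \<partial>lborel) * indicator ?B y \<partial>lborel)"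
  proof (rule nn_integral_cong)
    fix y :: 'a
    have "(\<integral>\<^sup>+x. indicator A (R x) \<partial>lborel) = (\<integral>\<^sup>+x. indicator A (R (S y + x)) \<partial>lborel)"
      by (rule shift[symmetric]) measurable
    then show "(\<integral>\<^sup>+x. indicator A (R x) \<partial>lborel) * indicator ?B y =
        (\<integral>\<^sup>+x. indicator A (R x + y) \<partial>lborel) * indicator ?B y"
      by (simp add: linear_add[OF lin] RS add.commute)
  qed
  also have "\<dots> = (\<integral>\<^sup>+y. (\<integral>\<^sup>+x. indicator A (R x + y) * indicator ?B y \<partial>lborel) \<partial>lborel)"
    by (intro nn_integral_cong nn_integral_multc[symmetric]) measurable
  also have "\<dots> = (\<integral>\<^sup>+x. (\<integral>\<^sup>+y. indicator A (R x + y) * indicator ?B y \<partial>lborel) \<partial>lborel)"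
    by (rule lborel_pair.Fubini') measurable
  also have "\<dots> = (\<integral>\<^sup>+x. (\<integral>\<^sup>+y. indicator A y * indicator ?B (y - R x) \<partial>lborel) \<partial>lborel)"
  proof (rule nn_integral_cong)
    fix x :: 'a
    show "(\<integral>\<^sup>+y. indicator A (R x + y) * indicator ?B y \<partial>lborel) =
        (\<integral>\<^sup>+y. indicator A y * indicator ?B (y - R x) \<partial>lborel)"
      by (subst shift[symmetric, of _ "R x"]) (simp_all)
  qed
  also have "\<dots> = (\<integral>\<^sup>+y. (\<integral>\<^sup>+x. indicator A y * indicator ?B (y - R x) \<partial>lborel) \<partial>lborel)"
    by (rule lborel_pair.Fubini') measurable
  also have "\<dots> = (\<integral>\<^sup>+y. indicator A y * emeasure lborel ?B \<partial>lborel)"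
  proof (rule nn_integral_cong)
    fix y :: 'a
    have "(\<integral>\<^sup>+x. indicator ?B (y - R x) \<partial>lborel) = (\<integral>\<^sup>+x. indicator ?B (y - R (S y + x)) \<partial>lborel)"
      by (rule shift[symmetric]) measurable
    also have "\<dots> = (\<integral>\<^sup>+x. indicator ?B x \<partial>lborel)"
      by (intro nn_integral_cong) (auto simp: linear_add[OF lin] RS norm split: split_indicator)
    finally show "(\<integral>\<^sup>+x. indicator A y * indicator ?B (y - R x) \<partial>lborel) =
        indicator A y * emeasure lborel ?B"
      by (subst nn_integral_cmult) auto
  qed
  also have "\<dots> = emeasure lborel A * emeasure lborel ?B"
    by (subst nn_integral_multc) auto
  finally have "emeasure lborel ?B * emeasure lborel (R -` A) = emeasure lborel ?B * emeasure lborel A"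
    by (simp add: mult.commute)
  moreover have "emeasure lborel ?B \<noteq> 0" "emeasure lborel ?B \<noteq> \<infinity>"
    using emeasure_lborel_ball_finite[of 0 1] content_ball_pos[of 1 "0::'a"]
    by (auto simp: measure_def)
  ultimately show "emeasure (distr lborel borel R) A = emeasure lborel A"
    by (simp add: emeasure_distr ennreal_mult_cancel_left)
qed simp

subsection \<open>Rotations of a coordinate plane\<close>

text \<open>
  For distinct basis vectors \<open>i\<close> and \<open>j\<close>, the rotation by the angle \<open>t\<close> in the plane spanned by them.
\<close>

definition rotation :: "'a \<Rightarrow> 'a \<Rightarrow> real \<Rightarrow> 'a::euclidean_space \<Rightarrow> 'a" where
  "rotation i j t x = x + ((cos t - 1) * (x \<bullet> i) - sin t * (x \<bullet> j)) *\<^sub>R i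
     + (sin t * (x \<bullet> i) + (cos t - 1) * (x \<bullet> j)) *\<^sub>R j"

lemma rotation_0 [simp]: "rotation i j 0 x = x"
  by (simp add: rotation_def)

context
  fixes i j :: "'a::euclidean_space"
  assumes ij: "i \<in> Basis" "j \<in> Basis" "i \<noteq> j"
begin

lemma rotation_inner:
  "rotation i j t x \<bullet> i = cos t * (x \<bullet> i) - sin t * (x \<bullet> j)"
  "rotation i j t x \<bullet> j = sin t * (x \<bullet> i) + cos t * (x \<bullet> j)"
  using ij by (simp_all add: rotation_def inner_add_left inner_Basis algebra_simps)

lemma rotation_rotation: "rotation i j s (rotation i j t x) = rotation i j (s + t) x"
proof -
  have "rotation i j s (rotation i j t x) = rotation i j t x
      + ((cos s - 1) * (rotation i j t x \<bullet> i) - sin s * (rotation i j t x \<bullet> j)) *\<^sub>R i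
      + (sin s * (rotation i j t x \<bullet> i) + (cos s - 1) * (rotation i j t x \<bullet> j)) *\<^sub>R j"
    by (simp add: rotation_def[of i j s])
  then show ?thesis
    unfolding rotation_inner by (simp add: rotation_def cos_add sin_add algebra_simps)
qed

lemma orthogonal_transformation_rotation: "orthogonal_transformation (rotation i j t)"
  unfolding orthogonal_transformation
proof
  show "linear (rotation i j t)"
    by (rule linearI) (simp_all add: rotation_def inner_add_left algebra_simps)
  have alg: "((c - 1) * a - s * b) * a + (s * a + (c - 1) * b) * b +
      ((c - 1) * a - s * b) * (c * a - s * b) + (s * a + (c - 1) * b) * (s * a + c * b) =
      (a\<^sup>2 + b\<^sup>2) * (c\<^sup>2 + s\<^sup>2 - 1)" for a b c s :: real
    by algebra
  show "\<forall>v. norm (rotation i j t v) = norm v"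
  proof
    fix v
    have "rotation i j t v \<bullet> rotation i j t v = rotation i j t v \<bullet> v
      + ((cos t - 1) * (v \<bullet> i) - sin t * (v \<bullet> j)) * (rotation i j t v \<bullet> i)
      + (sin t * (v \<bullet> i) + (cos t - 1) * (v \<bullet> j)) * (rotation i j t v \<bullet> j)"
      by (subst (2) rotation_def) (simp add: inner_add_right)
    also have "rotation i j t v \<bullet> v = v \<bullet> v
      + ((cos t - 1) * (v \<bullet> i) - sin t * (v \<bullet> j)) * (v \<bullet> i)
      + (sin t * (v \<bullet> i) + (cos t - 1) * (v \<bullet> j)) * (v \<bullet> j)"
      by (simp add: rotation_def inner_add_left inner_commute[of i v] inner_commute[of j v])
    finally have "rotation i j t v \<bullet> rotation i j t v =
        v \<bullet> v + ((v \<bullet> i)\<^sup>2 + (v \<bullet> j)\<^sup>2) * ((cos t)\<^sup>2 + (sin t)\<^sup>2 - 1)"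
      unfolding rotation_inner using alg[of "cos t" "v \<bullet> i" "sin t" "v \<bullet> j"] by linarith
    then show "norm (rotation i j t v) = norm v"
      by (simp add: norm_eq_sqrt_inner)
  qed
qed

lemma norm_rotation [simp]: "norm (rotation i j t x) = norm x"
  using orthogonal_transformation_rotation by (rule orthogonal_transformation_norm)

lemma rotation_has_derivative:
  "((\<lambda>t. rotation i j t x) has_derivative (\<lambda>t. t *\<^sub>R ((x \<bullet> i) *\<^sub>R j - (x \<bullet> j) *\<^sub>R i))) (at 0)"
  unfolding rotation_def by (auto intro!: derivative_eq_intros simp: algebra_simps)

text \<open>
  The integral of \<open>v \<circ> R\<^sub>t\<close> does not depend on \<open>t\<close>; differentiate it at \<open>t = 0\<close> under the integral sign.
\<close>

lemma integral_rotation_derivative_zero: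
  assumes M: "finite_measure M"
    and R [measurable]: "\<And>t. rotation i j t \<in> measurable M M"
    and inv: "\<And>t. distr M M (rotation i j t) = M"
    and [measurable]: "v \<in> borel_measurable M" "v' \<in> borel_measurable M"
    and bound: "\<And>x. x \<in> space M \<Longrightarrow> \<bar>v x\<bar> \<le> C" "\<And>x. x \<in> space M \<Longrightarrow> \<bar>v' x\<bar> \<le> C"
    and deriv: "\<And>x. x \<in> space M \<Longrightarrow> ((\<lambda>t. v (rotation i j t x)) has_real_derivative v' x) (at 0)"
  shows "(LINT x|M. v' x) = 0"
proof -
  interpret finite_measure M by (rule M)
  have space: "rotation i j t x \<in> space M" if "x \<in> space M" for t x
    using measurable_space[OF R that] .
  have deriv_all: "((\<lambda>t. v (rotation i j t x)) has_real_derivative v' (rotation i j t x)) (at t)"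
    if "x \<in> space M" for x t
  proof -
    have "((\<lambda>s. v (rotation i j (s + t) x)) has_real_derivative v' (rotation i j t x)) (at 0)"
      using deriv[OF space[OF that, of t]] by (simp add: rotation_rotation)
    then show ?thesis
      using DERIV_shift[of "\<lambda>t. v (rotation i j t x)" "v' (rotation i j t x)" 0 t] by simp
  qed
  define q where "q k x = (v (rotation i j (1 / real (Suc k)) x) - v x) / (1 / real (Suc k))" for k x
  have v_int: "integrable M v"
    by (rule integrable_const_bound[where B = C]) (auto simp: bound)
  have q_int: "(LINT x|M. q k x) = 0" for k
  proof -
    have "integrable M (\<lambda>x. v (rotation i j (1 / real (Suc k)) x))"
      by (rule integrable_const_bound[where B = C]) (auto simp: bound space)
    moreover have "(LINT x|M. v (rotation i j (1 / real (Suc k)) x)) = (LINT x|M. v x)"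
      by (subst (2) inv[symmetric, of "1 / real (Suc k)"], subst integral_distr) simp_all
    ultimately show ?thesis
      unfolding q_def by (simp add: v_int)
  qed
  have "(\<lambda>k. LINT x|M. q k x) \<longlonglongrightarrow> (LINT x|M. v' x)"
  proof (rule integral_dominated_convergence[where w = "\<lambda>x. C"])
    show "q k \<in> borel_measurable M" for k
      unfolding q_def by measurable
    show "AE x in M. (\<lambda>k. q k x) \<longlonglongrightarrow> v' x"
    proof (rule AE_I2)
      fix x
      assume "x \<in> space M"
      from deriv[OF this] have lim: "((\<lambda>h. (v (rotation i j h x) - v x) / h) \<longlongrightarrow> v' x) (at 0)"
        by (simp add: has_field_derivative_iff)
      have seq: "filterlim (\<lambda>k. 1 / real (Suc k)) (at 0) sequentially"
        unfolding filterlim_at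
        using LIMSEQ_inverse_real_of_nat by (auto simp: inverse_eq_divide)
      show "(\<lambda>k. q k x) \<longlonglongrightarrow> v' x"
        unfolding q_def using filterlim_compose[OF lim seq] .
    qed
    show "AE x in M. norm (q k x) \<le> C" for k
    proof (rule AE_I2)
      fix x
      assume x: "x \<in> space M"
      obtain z where "v (rotation i j (1 / real (Suc k)) x) - v (rotation i j 0 x) =
          (1 / real (Suc k) - 0) * v' (rotation i j z x)"
        using MVT2[of 0 "1 / real (Suc k)" "\<lambda>t. v (rotation i j t x)" "\<lambda>t. v' (rotation i j t x)"]
          deriv_all[OF x] by auto
      then have "q k x = v' (rotation i j z x)"
        unfolding q_def by simp
      then show "norm (q k x) \<le> C"
        using bound(2)[OF space[OF x]] by simp
    qed
  qed auto
  then show ?thesis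
    by (simp add: q_int LIMSEQ_const_iff)
qed

end

subsection \<open>Rotation invariance of the measures on the sphere and on the ball\<close>

lemma emeasure_unit_ball:
  "emeasure lborel (ball (0::'a::euclidean_space) 1) \<noteq> 0"
  "emeasure lborel (ball (0::'a::euclidean_space) 1) \<noteq> \<infinity>"
  using emeasure_lborel_ball_finite[of 0 1] content_ball_pos[of 1 "0::'a"]
  by (auto simp: measure_def)

lemma space_sphere_measure [simp]: "space sphere_measure = (sphere 0 1 :: 'a::euclidean_space set)"
  by (simp add: sphere_measure_def space_restrict_space)

lemma sets_sphere_measure [measurable_cong]:
  "sets sphere_measure = sets (restrict_space borel (sphere (0::'a::euclidean_space) 1))"
  unfolding sphere_measure_def by (intro sets_restrict_space_cong) simp

lemma sgn_measurable [measurable]: "sgn \<in> borel_measurable (borel :: 'a::euclidean_space measure)"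
  unfolding sgn_div_norm[abs_def] by measurable

lemma nn_integral_sphere_measure:
  fixes h :: "'a::euclidean_space \<Rightarrow> ennreal"
  assumes [measurable]: "h \<in> borel_measurable borel"
  shows "(\<integral>\<^sup>+x. h x \<partial>sphere_measure) =
    (\<integral>\<^sup>+y. h (sgn y) * indicator (ball 0 1) y \<partial>lborel) / emeasure lborel (ball (0::'a) 1)"
proof -
  have [measurable]: "sphere (0::'a) 1 \<in> sets borel" "ball (0::'a) 1 \<in> sets borel"
    by simp_all
  have "(\<integral>\<^sup>+x. h x \<partial>sphere_measure) =
      (\<integral>\<^sup>+y. h (sgn y) * indicator (sphere 0 1) (sgn y) * indicator (ball 0 1) y \<partial>lborel) /
        emeasure lborel (ball (0::'a) 1)"
    unfolding sphere_measure_def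
    by (simp add: nn_integral_restrict_space nn_integral_distr nn_integral_uniform_measure)
  also have "(\<integral>\<^sup>+y. h (sgn y) * indicator (sphere 0 1) (sgn y) * indicator (ball 0 1) y \<partial>lborel) =
      (\<integral>\<^sup>+y. h (sgn y) * indicator (ball 0 1) y \<partial>lborel)"
    by (rule nn_integral_cong_AE, rule AE_mp[OF AE_lborel_singleton[of 0]])
       (auto simp: norm_sgn split: split_indicator)
  finally show ?thesis .
qed

lemma emeasure_sphere_measure:
  fixes A :: "'a::euclidean_space set"
  assumes "A \<in> sets borel" "A \<subseteq> sphere 0 1"
  shows "emeasure sphere_measure A =
    emeasure lborel (ball 0 1 \<inter> sgn -` A) / emeasure lborel (ball (0::'a) 1)"
proof -
  have "sgn -` A \<in> sets borel"
    using measurable_sets_borel[OF sgn_measurable assms(1)] .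
  then show ?thesis
    unfolding sphere_measure_def using assms
    by (simp add: emeasure_restrict_space emeasure_distr)
qed

lemma emeasure_space_sphere_measure: "emeasure sphere_measure (sphere (0::'a::euclidean_space) 1) = 1"
proof -
  have "emeasure sphere_measure (sphere (0::'a) 1) = (\<integral>\<^sup>+x. 1 \<partial>(sphere_measure :: 'a measure))"
    by simp
  also have "\<dots> = 1"
    by (subst nn_integral_sphere_measure)
       (use emeasure_unit_ball[where 'a = 'a] in \<open>simp_all add: ennreal_divide_self less_top\<close>)
  finally show ?thesis .
qed

lemma finite_measure_sphere_measure: "finite_measure (sphere_measure :: 'a::euclidean_space measure)"
  by (rule finite_measureI) (simp add: emeasure_space_sphere_measure)

lemma measure_sphere_measure [simp]: "measure sphere_measure (sphere (0::'a::euclidean_space) 1) = 1"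
  by (simp add: measure_def emeasure_space_sphere_measure)

lemma sets_sphere_measure_iff:
  "A \<in> sets sphere_measure \<longleftrightarrow> A \<in> sets borel \<and> A \<subseteq> sphere (0::'a::euclidean_space) 1"
  unfolding sets_sphere_measure by (subst sets_restrict_space_iff) auto

lemma sphere_measure_orthogonal:
  fixes R :: "'a::euclidean_space \<Rightarrow> 'a"
  assumes R: "orthogonal_transformation R"
  shows "R \<in> measurable sphere_measure sphere_measure"
    and "distr sphere_measure sphere_measure R = sphere_measure"
proof -
  note R_borel [measurable] = orthogonal_transformation_measurable[OF R]
  have norm: "norm (R x) = norm x" for x
    using R by (simp add: orthogonal_transformation_norm)
  have sgn: "sgn (R x) = R (sgn x)" for x
    using R by (simp add: sgn_div_norm norm orthogonal_transformation_linear linear_scale)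
  show R_meas: "R \<in> measurable sphere_measure sphere_measure"
    unfolding measurable_cong_sets[OF sets_sphere_measure sets_sphere_measure]
    by (rule measurable_restrict_space3) (auto simp: norm R_borel)
  show "distr sphere_measure sphere_measure R = sphere_measure"
  proof (rule measure_eqI)
    fix A
    assume "A \<in> sets (distr sphere_measure sphere_measure R)"
    then have A: "A \<in> sets borel" "A \<subseteq> sphere 0 1"
      by (simp_all add: sets_sphere_measure_iff)
    have RA: "R -` A \<in> sets borel"
      using measurable_sets_borel[OF R_borel A(1)] .
    have RA_sub: "R -` A \<subseteq> sphere 0 1"
      using A(2) norm by fastforce
    have sA: "ball 0 1 \<inter> sgn -` A \<in> sets borel"
      using measurable_sets_borel[OF sgn_measurable A(1)] by simp
    have "emeasure (distr sphere_measure sphere_measure R) A = emeasure sphere_measure (R -` A)"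
      using A RA_sub by (subst emeasure_distr[OF R_meas]) (auto simp: sets_sphere_measure_iff Int_absorb2)
    also have "\<dots> = emeasure lborel (ball 0 1 \<inter> sgn -` (R -` A)) / emeasure lborel (ball (0::'a) 1)"
      by (rule emeasure_sphere_measure[OF RA RA_sub])
    also have "ball 0 1 \<inter> sgn -` (R -` A) = R -` (ball 0 1 \<inter> sgn -` A)"
      by (auto simp: sgn norm)
    also have "emeasure lborel (R -` (ball 0 1 \<inter> sgn -` A)) = emeasure lborel (ball 0 1 \<inter> sgn -` A)"
      using emeasure_distr[of R lborel borel] sA lborel_distr_orthogonal[OF R] by simp
    also have "\<dots> / emeasure lborel (ball (0::'a) 1) = emeasure sphere_measure A"
      by (rule emeasure_sphere_measure[OF A, symmetric])
    finally show "emeasure (distr sphere_measure sphere_measure R) A = emeasure sphere_measure A" .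
  qed simp
qed

lemma ball_measure_orthogonal:
  fixes R :: "'a::euclidean_space \<Rightarrow> 'a"
  assumes R: "orthogonal_transformation R"
  defines "M \<equiv> restrict_space lborel (ball 0 1)"
  shows "R \<in> measurable M M" and "distr M M R = M"
proof -
  note R_borel [measurable] = orthogonal_transformation_measurable[OF R]
  have norm: "norm (R x) = norm x" for x
    using R by (simp add: orthogonal_transformation_norm)
  have sets_M: "A \<in> sets M \<longleftrightarrow> A \<in> sets borel \<and> A \<subseteq> ball 0 1" for A
    unfolding M_def by (subst sets_restrict_space_iff) auto
  have space_M: "space M = ball 0 1"
    unfolding M_def by (simp add: space_restrict_space)
  show R_meas: "R \<in> measurable M M"
    unfolding M_def by (rule measurable_restrict_space3) (auto simp: norm R_borel)
  show "distr M M R = M"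
  proof (rule measure_eqI)
    fix A
    assume "A \<in> sets (distr M M R)"
    then have A: "A \<in> sets borel" "A \<subseteq> ball 0 1"
      by (simp_all add: sets_M)
    have RA: "R -` A \<in> sets borel" "R -` A \<subseteq> ball 0 1"
      using measurable_sets_borel[OF R_borel A(1)] A(2) norm by fastforce+
    have "emeasure (distr M M R) A = emeasure M (R -` A)"
      using A RA by (subst emeasure_distr[OF R_meas]) (auto simp: sets_M space_M Int_absorb2)
    also have "\<dots> = emeasure lborel (R -` A)"
      unfolding M_def using RA by (simp add: emeasure_restrict_space)
    also have "\<dots> = emeasure lborel A"
      using emeasure_distr[of R lborel borel] A lborel_distr_orthogonal[OF R] by simp
    also have "\<dots> = emeasure M A"
      unfolding M_def using A by (simp add: emeasure_restrict_space)
    finally show "emeasure (distr M M R) A = emeasure M A" .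
  qed simp
qed

lemma continuous_on_sphere_measurable:
  assumes "continuous_on (sphere (0::'a::euclidean_space) 1) (h :: 'a \<Rightarrow> 'b::topological_space)"
  shows "h \<in> borel_measurable sphere_measure"
  unfolding measurable_cong_sets[OF sets_sphere_measure refl]
  using assms by (rule borel_measurable_continuous_on_restrict)

lemma continuous_on_sphere_bounded:
  fixes h :: "'a::euclidean_space \<Rightarrow> real"
  assumes "continuous_on (sphere 0 1) h"
  obtains C where "\<And>x. norm x = 1 \<Longrightarrow> \<bar>h x\<bar> \<le> C"
proof -
  have "bounded (h ` sphere 0 1)"
    by (intro compact_imp_bounded compact_continuous_image assms compact_sphere)
  then obtain C where "\<forall>x\<in>sphere 0 1. \<bar>h x\<bar> \<le> C"
    unfolding bounded_iff by auto
  then show thesis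
    by (intro that[of C]) auto
qed

lemma continuous_on_sphere_integrable:
  fixes h :: "'a::euclidean_space \<Rightarrow> real"
  assumes "continuous_on (sphere 0 1) h"
  shows "integrable sphere_measure h"
proof -
  interpret finite_measure "sphere_measure :: 'a measure" by (rule finite_measure_sphere_measure)
  obtain C where "\<And>x. norm x = 1 \<Longrightarrow> \<bar>h x\<bar> \<le> C"
    using continuous_on_sphere_bounded[OF assms] by blast
  then show ?thesis
    by (intro integrable_const_bound[where B = C] AE_I2)
       (auto intro: continuous_on_sphere_measurable[OF assms])
qed

lemma integral_sphere_angular:
  fixes v v' :: "'a::euclidean_space \<Rightarrow> real"
  assumes "i \<in> Basis" "j \<in> Basis"
    and cont: "continuous_on (sphere 0 1) v" "continuous_on (sphere 0 1) v'"
    and deriv: "\<And>x. norm x = 1 \<Longrightarrow> ((\<lambda>t. v (rotation i j t x)) has_real_derivative v' x) (at 0)"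
    and "i \<noteq> j"
  shows "(LINT x|sphere_measure. v' x) = 0"
proof -
  obtain C1 where C1: "\<And>x. norm x = 1 \<Longrightarrow> \<bar>v x\<bar> \<le> C1"
    using continuous_on_sphere_bounded[OF cont(1)] by blast
  obtain C2 where C2: "\<And>x. norm x = 1 \<Longrightarrow> \<bar>v' x\<bar> \<le> C2"
    using continuous_on_sphere_bounded[OF cont(2)] by blast
  note R = sphere_measure_orthogonal[OF orthogonal_transformation_rotation[OF assms(1,2,6)]]
  show ?thesis
  proof (rule integral_rotation_derivative_zero[OF assms(1,2,6) _ R, where v = v and C = "max C1 C2"])
    show "finite_measure (sphere_measure :: 'a measure)" by (rule finite_measure_sphere_measure)
  qed (use C1 C2 deriv cont in \<open>auto intro: continuous_on_sphere_measurable simp: le_max_iff_disj\<close>)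
qed

lemma polynomial_rotation_derivative:
  assumes "real_polynomial_function p" "i \<in> Basis" "j \<in> Basis" "i \<noteq> j"
  shows "((\<lambda>t. p (rotation i j t x)) has_real_derivative angular i j p x) (at 0)"
proof -
  have "((\<lambda>t. p (rotation i j t x)) has_derivative
      (\<lambda>t. gradient p x \<bullet> (t *\<^sub>R ((x \<bullet> i) *\<^sub>R j - (x \<bullet> j) *\<^sub>R i)))) (at 0)"
    by (rule has_derivative_compose[where g = p and f = "\<lambda>t. rotation i j t x"])
       (use rotation_has_derivative[OF assms(2-4)] polynomial_has_derivative[OF assms(1)] in auto)
  moreover have "gradient p x \<bullet> ((x \<bullet> i) *\<^sub>R j - (x \<bullet> j) *\<^sub>R i) = angular i j p x"
    by (simp add: angular_def inner_diff_right gradient_inner assms)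
  ultimately show ?thesis
    by (simp add: has_field_derivative_def mult.commute[of _ "angular i j p x"])
qed

lemma integral_ball_angular:
  fixes p :: "'a::euclidean_space \<Rightarrow> real"
  assumes p: "real_polynomial_function p" and ij: "i \<in> Basis" "j \<in> Basis" "i \<noteq> j"
  shows "(LINT x|restrict_space lborel (ball 0 1). angular i j p x) = 0"
proof -
  have bdd: "\<exists>C. \<forall>x\<in>ball 0 1. \<bar>q x\<bar> \<le> C" if "real_polynomial_function q" for q :: "'a \<Rightarrow> real"
  proof -
    have "bounded (q ` cball 0 1)"
      by (intro compact_imp_bounded compact_continuous_image polynomial_continuous_on that compact_cball)
    then show ?thesis
      unfolding bounded_iff by fastforce
  qed
  obtain C1 where C1: "\<forall>x\<in>ball 0 1. \<bar>p x\<bar> \<le> C1"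
    using bdd[OF p] by blast
  obtain C2 where C2: "\<forall>x\<in>ball 0 1. \<bar>angular i j p x\<bar> \<le> C2"
    using bdd[OF angular_polynomial[OF p]] by blast
  note R = ball_measure_orthogonal[OF orthogonal_transformation_rotation[OF ij]]
  have meas: "q \<in> borel_measurable (restrict_space lborel (ball 0 1))"
    if "real_polynomial_function q" for q :: "'a \<Rightarrow> real"
    using borel_measurable_continuous_onI[OF polynomial_continuous_on[OF that]]
    by (simp add: measurable_restrict_space1)
  show ?thesis
  proof (rule integral_rotation_derivative_zero[OF ij _ R, where v = p and C = "max C1 C2"])
    show "finite_measure (restrict_space lborel (ball (0::'a) 1))"
      by (rule finite_measureI) (use emeasure_unit_ball(2) in \<open>simp add: emeasure_restrict_space space_restrict_space\<close>)
  qed (use C1 C2 meas p angular_polynomial[OF p] polynomial_rotation_derivative[OF p ij] in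
      \<open>auto simp: le_max_iff_disj space_restrict_space\<close>)
qed

section \<open>The spherical gradient\<close>

lemma derivative_along_rotation:
  assumes f: "(f has_derivative (\<lambda>h. w \<bullet> h)) (at x within sphere 0 1)" and x: "norm x = 1"
    and ij: "i \<in> Basis" "j \<in> Basis" "i \<noteq> j"
  shows "((\<lambda>t. f (rotation i j t x)) has_real_derivative
    ((x \<bullet> i) * (w \<bullet> j) - (x \<bullet> j) * (w \<bullet> i))) (at 0)"
proof -
  have "((\<lambda>t. f (rotation i j t x)) has_derivative
      (\<lambda>t. w \<bullet> (t *\<^sub>R ((x \<bullet> i) *\<^sub>R j - (x \<bullet> j) *\<^sub>R i)))) (at 0)"
  proof (rule has_derivative_in_compose[where g = f and f = "\<lambda>t. rotation i j t x"])
    show "((\<lambda>t. rotation i j t x) has_derivative (\<lambda>t. t *\<^sub>R ((x \<bullet> i) *\<^sub>R j - (x \<bullet> j) *\<^sub>R i))) (at 0)"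
      by (rule rotation_has_derivative[OF ij])
    show "(f has_derivative (\<lambda>h. w \<bullet> h)) (at (rotation i j 0 x) within range (\<lambda>t. rotation i j t x))"
      using f by (simp, rule has_derivative_subset) (auto simp: norm_rotation[OF ij] x)
  qed
  moreover have "(\<lambda>t. w \<bullet> (t *\<^sub>R ((x \<bullet> i) *\<^sub>R j - (x \<bullet> j) *\<^sub>R i))) =
      (*) ((x \<bullet> i) * (w \<bullet> j) - (x \<bullet> j) * (w \<bullet> i))"
    by (rule ext) (simp add: inner_diff_right algebra_simps)
  ultimately show ?thesis
    by (simp only: has_field_derivative_def)
qed

text \<open>
  The rotations of the coordinate planes move \<open>x\<close> along the sphere, with velocities that span the tangent
  space; the difference of two derivatives is therefore normal.
\<close>

lemma derivative_within_sphere_unique: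
  fixes x :: "'a::euclidean_space"
  assumes "(f has_derivative (\<lambda>h. w \<bullet> h)) (at x within sphere 0 1)"
    and "(f has_derivative (\<lambda>h. w' \<bullet> h)) (at x within sphere 0 1)" and x: "norm x = 1"
  shows "\<exists>c. w' = w + c *\<^sub>R x"
proof -
  define v where "v = w' - w"
  have v: "(x \<bullet> i) * (v \<bullet> j) = (x \<bullet> j) * (v \<bullet> i)" if "i \<in> Basis" "j \<in> Basis" for i j
  proof (cases "i = j")
    case False
    have "(x \<bullet> i) * (w \<bullet> j) - (x \<bullet> j) * (w \<bullet> i) = (x \<bullet> i) * (w' \<bullet> j) - (x \<bullet> j) * (w' \<bullet> i)"
      by (rule DERIV_unique[OF derivative_along_rotation derivative_along_rotation]) (use assms that False in auto)
    then show ?thesis by (simp add: v_def inner_diff_left algebra_simps)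
  qed simp
  have "v = (x \<bullet> v) *\<^sub>R x"
  proof (rule euclidean_eqI)
    fix j :: 'a
    assume j: "j \<in> Basis"
    have "v \<bullet> j = (x \<bullet> x) * (v \<bullet> j)"
      using x by (simp add: dot_square_norm)
    also have "\<dots> = (\<Sum>i\<in>Basis. (x \<bullet> i) * ((x \<bullet> i) * (v \<bullet> j)))"
      by (subst euclidean_inner) (simp add: sum_distrib_right mult.assoc)
    also have "\<dots> = (\<Sum>i\<in>Basis. (x \<bullet> i) * ((x \<bullet> j) * (v \<bullet> i)))"
      using v j by (intro sum.cong) auto
    also have "\<dots> = (x \<bullet> v) * (x \<bullet> j)"
      unfolding euclidean_inner[of x v] by (simp add: sum_distrib_left mult_ac)
    finally show "v \<bullet> j = (x \<bullet> v) *\<^sub>R x \<bullet> j" by simp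
  qed
  then have "w' = w + (x \<bullet> v) *\<^sub>R x" by (simp add: v_def algebra_simps)
  then show ?thesis by blast
qed

lemma tangential_derivative:
  fixes x :: "'a::euclidean_space"
  assumes "(f has_derivative (\<lambda>h. w \<bullet> h)) (at x within sphere 0 1)" and x: "norm x = 1"
  shows "(f has_derivative (\<lambda>h. (w - c *\<^sub>R x) \<bullet> h)) (at x within sphere 0 1)"
proof -
  \<comment> \<open>On the sphere, subtracting a multiple of \<open>|y|\<^sup>2 - 1\<close> changes the gradient but not \<open>f\<close>.\<close>
  have "((\<lambda>y. f y - c / 2 * (y \<bullet> y - 1)) has_derivative (\<lambda>h. (w - c *\<^sub>R x) \<bullet> h)) (at x within sphere 0 1)"
    using assms(1) by (auto intro!: derivative_eq_intros simp: inner_diff_left inner_commute algebra_simps)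
  then show ?thesis
    by (rule has_derivative_transform[rotated 2]) (auto simp: x dot_square_norm)
qed

text \<open>
  The admissible vectors form a line in direction \<open>x\<close>, whose shortest element is the tangential one.
\<close>

lemma spherical_gradient_eq:
  fixes x :: "'a::euclidean_space"
  assumes f: "(f has_derivative (\<lambda>h. w \<bullet> h)) (at x within sphere 0 1)" and x: "norm x = 1"
  shows "spherical_gradient f x = w - (w \<bullet> x) *\<^sub>R x"
proof -
  let ?P = "\<lambda>w. (f has_derivative (\<lambda>h. w \<bullet> h)) (at x within sphere 0 1)"
  define u where "u = w - (w \<bullet> x) *\<^sub>R x"
  have xx: "x \<bullet> x = 1" using x by (simp add: dot_square_norm)
  have u: "?P u" unfolding u_def by (rule tangential_derivative[OF f x])
  have "u \<bullet> x = 0" by (simp add: u_def inner_diff_left xx)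
  then have norm: "(norm (u + c *\<^sub>R x))\<^sup>2 = (norm u)\<^sup>2 + c\<^sup>2" for c
    unfolding power2_norm_eq_inner
    by (simp add: inner_add_left inner_add_right xx inner_commute[of x u] power2_eq_square)
  have min: "norm u \<le> norm v \<and> (norm v \<le> norm u \<longrightarrow> v = u)" if v: "?P v" for v
  proof -
    obtain c where c: "v = u + c *\<^sub>R x"
      using derivative_within_sphere_unique[OF u v x] by blast
    have "(norm u)\<^sup>2 \<le> (norm v)\<^sup>2"
      using norm[of c] by (simp add: c)
    then have "norm u \<le> norm v"
      using norm_ge_zero power2_le_imp_le by blast
    moreover have "v = u" if "norm v \<le> norm u"
    proof -
      have "(norm v)\<^sup>2 \<le> (norm u)\<^sup>2" using that by (simp add: power_mono)
      then have "c = 0" using norm[of c] by (simp add: c)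
      then show ?thesis by (simp add: c)
    qed
    ultimately show ?thesis by blast
  qed
  have "spherical_gradient f x = (SOME v. is_arg_min norm ?P v)"
    unfolding spherical_gradient_def arg_min_def ..
  also have "\<dots> = u"
    by (rule some_equality) (use u min in \<open>auto simp: is_arg_min_def not_less\<close>)
  finally show ?thesis by (simp add: u_def)
qed

lemma spherical_gradient_tangent:
  assumes "(f has_derivative (\<lambda>h. w \<bullet> h)) (at x within sphere 0 1)" and x: "norm x = 1"
  shows "(f has_derivative (\<lambda>h. spherical_gradient f x \<bullet> h)) (at x within sphere 0 1)"
    and "spherical_gradient f x \<bullet> x = 0"
proof -
  show "spherical_gradient f x \<bullet> x = 0"
    using x by (simp add: spherical_gradient_eq[OF assms] inner_diff_left dot_square_norm)
  show "(f has_derivative (\<lambda>h. spherical_gradient f x \<bullet> h)) (at x within sphere 0 1)"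
    unfolding spherical_gradient_eq[OF assms] using assms by (rule tangential_derivative)
qed

lemma C1_on_sphere_local:
  fixes f :: "'a::euclidean_space \<Rightarrow> real"
  assumes "C1_on_sphere f" "norm x = 1"
  obtains U G where "open U" "x \<in> U" "continuous_on U G"
    "\<And>y. y \<in> U \<Longrightarrow> norm y = 1 \<Longrightarrow> (f has_derivative (\<lambda>h. G y \<bullet> h)) (at y within sphere 0 1)"
proof -
  obtain U F G where U: "open U" "x \<in> U" and F: "\<And>y. y \<in> U \<Longrightarrow> (F has_derivative (\<lambda>h. G y \<bullet> h)) (at y)"
    and G: "continuous_on U (G :: 'a \<Rightarrow> 'a)" and eq: "\<And>y. y \<in> U \<inter> sphere 0 1 \<Longrightarrow> F y = f y"
    using assms unfolding C1_on_sphere_def by (metis mem_sphere_0)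
  have "(f has_derivative (\<lambda>h. G y \<bullet> h)) (at y within sphere 0 1)" if y: "y \<in> U" "norm y = 1" for y
  proof -
    obtain e where e: "e > 0" "ball y e \<subseteq> U"
      using U y by (meson open_contains_ball)
    have "(F has_derivative (\<lambda>h. G y \<bullet> h)) (at y within sphere 0 1)"
      using F[OF y(1)] by (rule has_derivative_at_withinI)
    then show ?thesis
      by (rule has_derivative_transform_within[OF _ e(1)])
         (use y e eq in \<open>auto simp: dist_commute subset_eq\<close>)
  qed
  with U G show thesis by (rule that)
qed

context
  fixes f :: "'a::euclidean_space \<Rightarrow> real"
  assumes f: "C1_on_sphere f"
begin

lemma C1_on_sphere_has_derivative:
  assumes "norm x = 1"
  shows "(f has_derivative (\<lambda>h. spherical_gradient f x \<bullet> h)) (at x within sphere 0 1)"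
    and "spherical_gradient f x \<bullet> x = 0"
  using C1_on_sphere_local[OF f assms] spherical_gradient_tangent assms by metis+

lemma C1_on_sphere_continuous_on: "continuous_on (sphere 0 1) f"
  unfolding continuous_on_eq_continuous_within
  by (auto intro!: has_derivative_continuous[OF C1_on_sphere_has_derivative(1)])

lemma C1_on_sphere_gradient_continuous_on: "continuous_on (sphere 0 1) (spherical_gradient f)"
  unfolding continuous_on_eq_continuous_within
proof
  fix x :: 'a
  assume "x \<in> sphere 0 1"
  then have x: "norm x = 1" by simp
  obtain U G where U: "open U" "x \<in> U" and G: "continuous_on U G"
    and der: "\<And>y. y \<in> U \<Longrightarrow> norm y = 1 \<Longrightarrow> (f has_derivative (\<lambda>h. G y \<bullet> h)) (at y within sphere 0 1)"
    using C1_on_sphere_local[OF f x] by blast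
  have "continuous_on (sphere 0 1 \<inter> U) (\<lambda>y. G y - (G y \<bullet> y) *\<^sub>R y)"
    by (intro continuous_intros continuous_on_subset[OF G]) auto
  then have "continuous_on (sphere 0 1 \<inter> U) (spherical_gradient f)"
    by (rule continuous_on_eq) (use spherical_gradient_eq[OF der] in auto)
  then have "continuous (at x within (sphere 0 1 \<inter> U)) (spherical_gradient f)"
    using x U by (simp add: continuous_on_eq_continuous_within)
  moreover have "at x within (sphere 0 1 \<inter> U) = at x within sphere 0 1"
    by (rule at_within_nhd[OF U(2,1)]) auto
  ultimately show "continuous (at x within sphere 0 1) (spherical_gradient f)" by simp
qed

end

lemma polynomial_C1_on_sphere: "real_polynomial_function p \<Longrightarrow> C1_on_sphere p"
  unfolding C1_on_sphere_def
  using polynomial_has_derivative polynomial_gradient_continuous_on open_UNIV by blast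

lemma spherical_gradient_polynomial:
  assumes "real_polynomial_function p" "norm x = 1"
  shows "spherical_gradient p x = gradient p x - (gradient p x \<bullet> x) *\<^sub>R x"
  by (rule spherical_gradient_eq[OF has_derivative_at_withinI[OF polynomial_has_derivative]]) (use assms in auto)

text \<open>
  On the sphere, \<open>\<langle>\<nabla>\<^sub>S f, \<nabla>u\<rangle>\<close> is half the sum of the products of the angular derivatives of \<open>f\<close> and \<open>u\<close>;
  each of these derivatives is moved from \<open>f\<close> to \<open>u\<close> by the rotation invariance of the measure, and half the
  sum of their squares is the spherical Laplacian.
\<close>

lemma integral_spherical_gradient_polynomial:
  fixes f u :: "'a::euclidean_space \<Rightarrow> real"
  assumes f: "C1_on_sphere f" and u: "real_polynomial_function u" and k: "homogeneous k u"
  shows "(LINT x|sphere_measure. spherical_gradient f x \<bullet> gradient u x) =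
    (LINT x|sphere_measure. f x * (real k * (real k + real DIM('a) - 2) * u x - laplacian u x))"
proof -
  define a where "a i j x = (x \<bullet> i) * (spherical_gradient f x \<bullet> j) - (x \<bullet> j) * (spherical_gradient f x \<bullet> i)"
    for i j x
  note cont_f = C1_on_sphere_continuous_on[OF f] C1_on_sphere_gradient_continuous_on[OF f]
  note cont_p = polynomial_continuous_on[of _ "sphere 0 1"]
  have cont_a: "continuous_on (sphere 0 1) (a i j)" for i j
    unfolding a_def by (intro continuous_intros cont_f)
  note [simp] = continuous_on_sphere_integrable
  have cont1: "continuous_on (sphere 0 1) (\<lambda>x. a i j x * angular i j u x)" for i j
    by (intro continuous_intros cont_a cont_p angular_polynomial u)
  have cont2: "continuous_on (sphere 0 1) (\<lambda>x. f x * angular i j (angular i j u) x)" for i j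
    by (intro continuous_intros cont_f cont_p angular_polynomial u)
  have parts: "(LINT x|sphere_measure. a i j x * angular i j u x) =
      - (LINT x|sphere_measure. f x * angular i j (angular i j u) x)"
    if ij: "i \<in> Basis" "j \<in> Basis" for i j
  proof (cases "i = j")
    case True
    then show ?thesis by (simp add: angular_def)
  next
    case False
    have "(LINT x|sphere_measure. a i j x * angular i j u x + f x * angular i j (angular i j u) x) = 0"
    proof (rule integral_sphere_angular[OF ij _ _ _ False])
      show "continuous_on (sphere 0 1) (\<lambda>x. f x * angular i j u x)"
        by (intro continuous_intros cont_f cont_p angular_polynomial u)
      show "continuous_on (sphere 0 1) (\<lambda>x. a i j x * angular i j u x + f x * angular i j (angular i j u) x)"
        by (intro continuous_on_add cont1 cont2)
      fix x :: 'a
      assume x: "norm x = 1"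
      show "((\<lambda>t. f (rotation i j t x) * angular i j u (rotation i j t x)) has_real_derivative
          a i j x * angular i j u x + f x * angular i j (angular i j u) x) (at 0)"
        using DERIV_mult[OF derivative_along_rotation[OF C1_on_sphere_has_derivative(1)[OF f x] x ij False]
            polynomial_rotation_derivative[OF angular_polynomial[OF u, of i j] ij False]]
        by (simp add: a_def mult.commute)
    qed
    then show ?thesis by (simp add: cont1 cont2)
  qed
  have "2 * (spherical_gradient f x \<bullet> gradient u x) = (\<Sum>i\<in>Basis. \<Sum>j\<in>Basis. a i j x * angular i j u x)"
    if "norm x = 1" for x
    using lagrange_identity[of x "spherical_gradient f x" "gradient u x"] that
      C1_on_sphere_has_derivative(2)[OF f that]
    by (simp add: a_def angular_def gradient_inner_Basis dot_square_norm
        inner_commute[of x "spherical_gradient f x"])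
  then have "2 * (LINT x|sphere_measure. spherical_gradient f x \<bullet> gradient u x) =
      (LINT x|sphere_measure. (\<Sum>i\<in>Basis. \<Sum>j\<in>Basis. a i j x * angular i j u x))"
    by (subst integral_mult_right_zero[symmetric], intro Bochner_Integration.integral_cong) auto
  also have "\<dots> = (\<Sum>i\<in>Basis. \<Sum>j\<in>Basis. LINT x|sphere_measure. a i j x * angular i j u x)"
    by (simp add: cont1)
  also have "\<dots> = - (\<Sum>i\<in>Basis. \<Sum>j\<in>Basis. LINT x|sphere_measure. f x * angular i j (angular i j u) x)"
    by (simp add: parts sum_negf)
  also have "\<dots> = - (LINT x|sphere_measure. (\<Sum>i\<in>Basis. \<Sum>j\<in>Basis. f x * angular i j (angular i j u) x))"
    by (simp add: cont2)
  also have "\<dots> = (LINT x|sphere_measure. 2 * (f x * (real k * (real k + real DIM('a) - 2) * u x - laplacian u x)))"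
    unfolding integral_minus[symmetric]
  proof (intro Bochner_Integration.integral_cong refl)
    fix x :: 'a
    assume "x \<in> space sphere_measure"
    then have "x \<bullet> x = 1" by (simp add: dot_square_norm)
    then show "- (\<Sum>i\<in>Basis. \<Sum>j\<in>Basis. f x * angular i j (angular i j u) x) =
        2 * (f x * (real k * (real k + real DIM('a) - 2) * u x - laplacian u x))"
      by (simp add: sum_distrib_left[symmetric] sum_angular_squared[OF u k] algebra_simps)
  qed
  finally show ?thesis by simp
qed

corollary integral_spherical_gradient_harmonic:
  fixes f F :: "'a::euclidean_space \<Rightarrow> real"
  assumes f: "C1_on_sphere f" and F: "F \<in> spherical_harmonics d"
  shows "(LINT x|sphere_measure. spherical_gradient f x \<bullet> gradient F x) =
    real d * (real DIM('a) + real d - 2) * (LINT x|sphere_measure. f x * F x)"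
  using integral_spherical_gradient_polynomial[OF f, of F d] F
  by (simp add: spherical_harmonics_iff mult.left_commute[of "f _"] add.commute)

lemma spherical_harmonics_orthogonal:
  fixes F G :: "'a::euclidean_space \<Rightarrow> real"
  assumes "2 \<le> DIM('a)" and F: "F \<in> spherical_harmonics d" and G: "G \<in> spherical_harmonics e" and "d \<noteq> e"
  shows "(LINT x|sphere_measure. F x * G x) = 0"
proof -
  let ?l = "\<lambda>d. real d * (real DIM('a) + real d - 2)"
  have poly: "real_polynomial_function F" "real_polynomial_function G"
    using F G by (auto simp: spherical_harmonics_iff)
  have "?l e * (LINT x|sphere_measure. F x * G x) =
      (LINT x|sphere_measure. spherical_gradient F x \<bullet> gradient G x)"
    by (rule integral_spherical_gradient_harmonic[OF polynomial_C1_on_sphere[OF poly(1)] G, symmetric])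
  also have "\<dots> = (LINT x|sphere_measure. spherical_gradient G x \<bullet> gradient F x)"
  proof (intro Bochner_Integration.integral_cong refl)
    fix x :: 'a
    assume "x \<in> space sphere_measure"
    then show "spherical_gradient F x \<bullet> gradient G x = spherical_gradient G x \<bullet> gradient F x"
      using inner_commute[of "gradient G x" "gradient F x"] inner_commute[of x "gradient F x"]
        inner_commute[of x "gradient G x"]
      by (simp add: spherical_gradient_polynomial poly inner_diff_left mult.commute)
  qed
  also have "\<dots> = ?l d * (LINT x|sphere_measure. F x * G x)"
    using integral_spherical_gradient_harmonic[OF polynomial_C1_on_sphere[OF poly(2)] F]
    by (simp add: mult.commute[of "F _"])
  finally have "(?l e - ?l d) * (LINT x|sphere_measure. F x * G x) = 0"
    by (simp add: algebra_simps)
  moreover have "?l e - ?l d = (real e - real d) * (real DIM('a) + real d + real e - 2)"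
    by (simp add: algebra_simps)
  moreover have "real DIM('a) + real d + real e - 2 > 0"
    using assms(1,4) by (cases d; cases e) auto
  ultimately show ?thesis using \<open>d \<noteq> e\<close> by auto
qed

text \<open>
  For harmonic \<open>p\<close>, \<open>|\<nabla>p|\<^sup>2 = \<Delta>(p\<^sup>2) / 2\<close>, and the mean of the Laplacian of a homogeneous polynomial is found
  by integrating by parts against the constant 1.
\<close>

lemma integral_gradient_squared:
  fixes p :: "'a::euclidean_space \<Rightarrow> real"
  assumes p: "p \<in> spherical_harmonics d"
  shows "(LINT x|sphere_measure. gradient p x \<bullet> gradient p x) =
    real d * (real DIM('a) + 2 * real d - 2) * (LINT x|sphere_measure. p x * p x)"
proof -
  let ?c = "\<lambda>x::'a. 1::real"
  have poly: "real_polynomial_function p" and hom: "homogeneous d p" and lap: "laplacian p x = 0" for x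
    using p by (auto simp: spherical_harmonics_iff)
  have pp: "real_polynomial_function (\<lambda>x. p x * p x)" "homogeneous (d + d) (\<lambda>x. p x * p x)"
    by (intro real_polynomial_function.intros(4) homogeneous_mult poly hom)+
  have c: "C1_on_sphere ?c"
    by (intro polynomial_C1_on_sphere real_polynomial_function.intros(2))
  have "spherical_gradient ?c x = 0" if "norm x = 1" for x
    using spherical_gradient_polynomial[of ?c x] that
    by (simp add: gradient_def real_polynomial_function.intros(2))
  then have "(LINT x|sphere_measure. spherical_gradient ?c x \<bullet> gradient (\<lambda>x. p x * p x) x) =
      (LINT x|(sphere_measure :: 'a measure). 0)"
    by (intro Bochner_Integration.integral_cong) auto
  then have "0 = (LINT x|sphere_measure. real (d + d) * (real (d + d) + real DIM('a) - 2) * (p x * p x) -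
      2 * (gradient p x \<bullet> gradient p x))"
    using integral_spherical_gradient_polynomial[OF c pp] by (simp add: laplacian_mult poly lap)
  also have "\<dots> = real (d + d) * (real (d + d) + real DIM('a) - 2) * (LINT x|sphere_measure. p x * p x) -
      2 * (LINT x|sphere_measure. gradient p x \<bullet> gradient p x)"
    by (subst Bochner_Integration.integral_diff)
       (simp_all add: continuous_on_sphere_integrable continuous_on_mult continuous_on_inner
          polynomial_continuous_on polynomial_gradient_continuous_on poly)
  finally show ?thesis by (simp add: algebra_simps)
qed

section \<open>Pointwise bounds for spherical harmonics\<close>

lemma polynomial_integrable_ball:
  fixes p :: "'a::euclidean_space \<Rightarrow> real"
  assumes "real_polynomial_function p"
  shows "integrable (restrict_space lborel (ball 0 1)) p"
proof -
  have "set_integrable lborel (cball 0 1) p"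
    unfolding set_integrable_def
    by (intro borel_integrable_compact compact_cball polynomial_continuous_on assms)
  then have "set_integrable lborel (ball 0 1) p"
    by (rule set_integrable_subset) (auto simp: ball_subset_cball)
  then show ?thesis
    by (simp add: integrable_restrict_space set_integrable_def)
qed

text \<open>
  A homogeneous harmonic polynomial of positive degree is an eigenfunction, with nonzero eigenvalue, of the
  sum of the squares of the angular derivatives, whose values have mean zero.
\<close>

lemma integral_ball_harmonic:
  fixes q :: "'a::euclidean_space \<Rightarrow> real"
  assumes "2 \<le> DIM('a)" and q: "q \<in> spherical_harmonics k" and "0 < k"
  shows "(LINT x|restrict_space lborel (ball 0 1). q x) = 0"
proof -
  let ?M = "restrict_space lborel (ball (0::'a) 1)"
  have poly: "real_polynomial_function q" and hom: "homogeneous k q" and lap: "laplacian q x = 0" for x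
    using q by (auto simp: spherical_harmonics_iff)
  have zero: "(LINT x|?M. angular i j (angular i j q) x) = 0" if "i \<in> Basis" "j \<in> Basis" for i j
  proof (cases "i = j")
    case True
    then show ?thesis by (simp add: angular_def)
  next
    case False
    then show ?thesis
      using that by (intro integral_ball_angular angular_polynomial poly)
  qed
  have "0 = (\<Sum>i\<in>Basis. \<Sum>j\<in>Basis. LINT x|?M. angular i j (angular i j q) x)"
    by (simp add: zero)
  also have "\<dots> = (LINT x|?M. (\<Sum>i\<in>Basis. \<Sum>j\<in>Basis. angular i j (angular i j q) x))"
    by (simp add: polynomial_integrable_ball poly angular_polynomial)
  also have "\<dots> = (LINT x|?M. - 2 * (real k * (real k + real DIM('a) - 2)) * q x)"
    by (simp add: sum_angular_squared[OF poly hom] lap)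
  also have "\<dots> = - 2 * (real k * (real k + real DIM('a) - 2)) * (LINT x|?M. q x)"
    by (rule integral_mult_right_zero)
  finally show ?thesis
    using assms(1,3) by simp
qed

text \<open>The mean value property, since the homogeneous components of positive degree have mean zero.\<close>

lemma integral_ball_mean_value:
  fixes q :: "'a::euclidean_space \<Rightarrow> real"
  assumes "2 \<le> DIM('a)" and q: "real_polynomial_function q" and lap: "\<And>x. laplacian q x = 0"
  shows "(LINT x|restrict_space lborel (ball 0 1). q x) = measure lborel (ball (0::'a) 1) * q 0"
proof -
  let ?M = "restrict_space lborel (ball (0::'a) 1)"
  obtain P D where P: "\<And>k. P k \<in> spherical_harmonics k" and sum: "q = (\<lambda>x. \<Sum>k\<le>D. P k x)"
    using harmonic_homogeneous_components[OF q lap] by metis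
  have hom: "homogeneous k (P k)" and poly: "real_polynomial_function (P k)" for k
    using P[of k] by (auto simp: spherical_harmonics_iff)
  have const: "P 0 x = P 0 0" for x
    using homogeneousD[OF hom, of 0 0 x] by simp
  have zero: "P k 0 = 0" if "0 < k" for k
    using homogeneousD[OF hom, of k 0 0] that by (simp add: power_0_left)
  have "(LINT x|?M. q x) = (\<Sum>k\<le>D. LINT x|?M. P k x)"
    unfolding sum by (rule Bochner_Integration.integral_sum) (rule polynomial_integrable_ball[OF poly])
  also have "\<dots> = (\<Sum>k\<in>{0}. LINT x|?M. P k x)"
    by (rule sum.mono_neutral_right) (use integral_ball_harmonic[OF assms(1) P] in auto)
  also have "\<dots> = (LINT x|?M. P 0 x)"
    by simp
  also have "\<dots> = (LINT x|?M. P 0 0)"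
    by (intro Bochner_Integration.integral_cong refl const)
  also have "\<dots> = measure lborel (ball (0::'a) 1) * P 0 0"
    by (simp add: measure_restrict_space space_restrict_space)
  also have "P 0 0 = q 0"
    unfolding sum using zero by (subst sum.remove[of _ 0]) auto
  finally show ?thesis .
qed

lemma partial_deriv_translate: "partial_deriv b (\<lambda>y. p (x + y)) = (\<lambda>y. partial_deriv b p (x + y))"
  by (simp add: partial_deriv_def fun_eq_iff add.assoc)

lemma laplacian_translate: "laplacian (\<lambda>y. p (x + y)) y = laplacian p (x + y)"
  by (simp add: laplacian_def partial_deriv_translate)

lemma polynomial_translate:
  fixes p :: "'a::euclidean_space \<Rightarrow> real"
  assumes "real_polynomial_function p"
  shows "real_polynomial_function (\<lambda>y. p (x + y))"
proof -
  have "polynomial_function (\<lambda>y::'a. x + y)"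
    by (intro polynomial_function_add polynomial_function_const polynomial_function_id[unfolded id_def])
  from real_polynomial_function_compose[OF this assms] show ?thesis by (simp add: o_def)
qed

text \<open>
  By the mean value property, \<open>p(x)\<close> is the average of \<open>p\<close> over the unit ball at \<open>x\<close>, which is contained in the ball
  of radius 2 at the origin; by homogeneity, the integral of \<open>|p|\<close> over the latter is controlled by
  the integral over the sphere.
\<close>

lemma spherical_harmonic_bound_L1:
  fixes p :: "'a::euclidean_space \<Rightarrow> real"
  assumes n: "2 \<le> DIM('a)" and p: "p \<in> spherical_harmonics d" and x: "norm x = 1"
  shows "\<bar>p x\<bar> \<le> 2 ^ (DIM('a) + d) * (LINT y|sphere_measure. \<bar>p y\<bar>)"
proof -
  let ?B = "ball (0::'a) 1"
  let ?N = "DIM('a)"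
  have poly: "real_polynomial_function p" and hom: "homogeneous d p" and lap: "laplacian p x = 0" for x
    using p by (auto simp: spherical_harmonics_iff)
  define V where "V = measure lborel ?B"
  have V: "V > 0" "emeasure lborel ?B = ennreal V"
    unfolding V_def using content_ball_pos[of 1 "0::'a"] emeasure_unit_ball(2)[where 'a = 'a]
    by (auto simp: emeasure_eq_ennreal_measure)
  have meas [measurable]: "p \<in> borel_measurable borel"
    by (intro borel_measurable_continuous_onI polynomial_continuous_on poly)
  have [measurable]: "ball z r \<in> sets borel" for z :: 'a and r by simp
  define I where "I = (\<integral>\<^sup>+y. ennreal \<bar>p (sgn y)\<bar> * indicator ?B y \<partial>lborel)"
  have "V * p x = (LINT y|restrict_space lborel ?B. p (x + y))"
    unfolding V_def
    by (subst integral_ball_mean_value) (auto simp: n laplacian_translate lap polynomial_translate poly)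
  then have "ennreal (V * \<bar>p x\<bar>) = ennreal (norm (LINT y|restrict_space lborel ?B. p (x + y)))"
    using V(1) by (metis abs_mult abs_of_pos real_norm_def)
  also have "\<dots> \<le> (\<integral>\<^sup>+y. ennreal (norm (p (x + y))) \<partial>restrict_space lborel ?B)"
    by (intro integral_norm_bound_ennreal polynomial_integrable_ball polynomial_translate poly)
  also have "\<dots> = (\<integral>\<^sup>+y. ennreal \<bar>p (x + y)\<bar> * indicator ?B y \<partial>lborel)"
    by (simp add: nn_integral_restrict_space)
  also have "\<dots> = (\<integral>\<^sup>+y. ennreal \<bar>p y\<bar> * indicator ?B (y - x) \<partial>lborel)"
    by (subst (2) lborel_distr_plus[symmetric, of x], subst nn_integral_distr) simp_all
  also have "\<dots> \<le> (\<integral>\<^sup>+y. ennreal \<bar>p y\<bar> * indicator (ball 0 2) y \<partial>lborel)"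
  proof (intro nn_integral_mono mult_left_mono)
    fix y :: 'a
    show "indicator ?B (y - x) \<le> (indicator (ball 0 2) y :: ennreal)"
      using norm_triangle_ineq[of "y - x" x] x by (auto split: split_indicator)
  qed simp
  also have "\<dots> = (\<integral>\<^sup>+y. ennreal (2 ^ ?N) * (ennreal \<bar>p (2 *\<^sub>R y)\<bar> * indicator (ball 0 2) (2 *\<^sub>R y)) \<partial>lborel)"
    by (subst lborel_affine[of 2 0]) (simp_all add: nn_integral_density nn_integral_distr)
  also have "\<dots> = (\<integral>\<^sup>+y. ennreal (2 ^ (?N + d)) * (ennreal \<bar>p y\<bar> * indicator ?B y) \<partial>lborel)"
  proof (intro nn_integral_cong)
    fix y :: 'a
    have "indicator (ball 0 2) (2 *\<^sub>R y) = (indicator ?B y :: ennreal)"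
      by (auto split: split_indicator)
    moreover have "ennreal \<bar>p (2 *\<^sub>R y)\<bar> = ennreal (2 ^ d) * ennreal \<bar>p y\<bar>"
      by (simp add: homogeneousD[OF hom] abs_mult ennreal_mult')
    ultimately show "ennreal (2 ^ ?N) * (ennreal \<bar>p (2 *\<^sub>R y)\<bar> * indicator (ball 0 2) (2 *\<^sub>R y)) =
        ennreal (2 ^ (?N + d)) * (ennreal \<bar>p y\<bar> * indicator ?B y)"
      by (simp add: power_add mult.assoc ennreal_mult')
  qed
  also have "\<dots> = ennreal (2 ^ (?N + d)) * (\<integral>\<^sup>+y. ennreal \<bar>p y\<bar> * indicator ?B y \<partial>lborel)"
    by (rule nn_integral_cmult) measurable
  also have "\<dots> \<le> ennreal (2 ^ (?N + d)) * I"
    unfolding I_def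
  proof (intro mult_left_mono nn_integral_mono_AE, rule AE_mp[OF AE_lborel_singleton[of 0]], intro AE_I2 impI)
    fix y :: 'a
    assume "y \<noteq> 0"
    then have y: "y = norm y *\<^sub>R sgn y" by (simp add: sgn_div_norm)
    have "\<bar>p y\<bar> = norm y ^ d * \<bar>p (sgn y)\<bar>"
      by (subst y) (simp add: homogeneousD[OF hom] abs_mult)
    then have "\<bar>p y\<bar> \<le> \<bar>p (sgn y)\<bar>" if "norm y \<le> 1"
      using that by (simp add: mult_left_le_one_le power_le_one)
    then show "ennreal \<bar>p y\<bar> * indicator ?B y \<le> ennreal \<bar>p (sgn y)\<bar> * indicator ?B y"
      by (auto split: split_indicator intro!: ennreal_leI)
  qed simp
  also have "I = ennreal V * (\<integral>\<^sup>+y. ennreal \<bar>p y\<bar> \<partial>sphere_measure)"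
  proof -
    have "(\<integral>\<^sup>+y. ennreal \<bar>p y\<bar> \<partial>sphere_measure) = I / ennreal V"
      unfolding I_def V(2)[symmetric] by (rule nn_integral_sphere_measure) measurable
    then show ?thesis
      using V(1) by (simp add: ennreal_times_divide ennreal_mult_divide_eq mult.commute)
  qed
  also have "(\<integral>\<^sup>+y. ennreal \<bar>p y\<bar> \<partial>sphere_measure) = ennreal (LINT y|sphere_measure. \<bar>p y\<bar>)"
    by (rule nn_integral_eq_integral)
       (auto intro!: continuous_on_sphere_integrable continuous_on_rabs[OF polynomial_continuous_on[OF poly]])
  also have "ennreal (2 ^ (?N + d)) * (ennreal V * ennreal (LINT y|sphere_measure. \<bar>p y\<bar>)) =
      ennreal (V * (2 ^ (?N + d) * (LINT y|sphere_measure. \<bar>p y\<bar>)))"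
    using V(1) by (simp flip: ennreal_mult add: mult_ac)
  finally show ?thesis
    using V(1) by (simp add: ennreal_le_iff)
qed

subsection \<open>The inner product of functions on the sphere\<close>

definition sphere_inner :: "('a::euclidean_space \<Rightarrow> real) \<Rightarrow> ('a \<Rightarrow> real) \<Rightarrow> real" where
  "sphere_inner f g = (LINT x|sphere_measure. f x * g x)"

lemma sphere_inner_commute: "sphere_inner f g = sphere_inner g f"
  unfolding sphere_inner_def by (simp add: mult.commute)

lemma sphere_inner_cong:
  "(\<And>x. norm x = 1 \<Longrightarrow> f x = f' x) \<Longrightarrow> (\<And>x. norm x = 1 \<Longrightarrow> g x = g' x) \<Longrightarrow>
    sphere_inner f g = sphere_inner f' g'"
  unfolding sphere_inner_def by (intro Bochner_Integration.integral_cong) auto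

abbreviation cont_sphere :: "('a::euclidean_space \<Rightarrow> real) \<Rightarrow> bool" where
  "cont_sphere f \<equiv> continuous_on (sphere 0 1) f"

lemma sphere_inner_add:
  "cont_sphere f \<Longrightarrow> cont_sphere g \<Longrightarrow> cont_sphere h \<Longrightarrow>
     sphere_inner (\<lambda>x. f x + g x) h = sphere_inner f h + sphere_inner g h"
  unfolding sphere_inner_def
  by (simp add: distrib_right continuous_on_sphere_integrable continuous_on_mult)

lemma sphere_inner_diff:
  "cont_sphere f \<Longrightarrow> cont_sphere g \<Longrightarrow> cont_sphere h \<Longrightarrow>
     sphere_inner (\<lambda>x. f x - g x) h = sphere_inner f h - sphere_inner g h"
  unfolding sphere_inner_def
  by (simp add: left_diff_distrib continuous_on_sphere_integrable continuous_on_mult)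

lemma sphere_inner_cmult: "sphere_inner (\<lambda>x. c * f x) h = c * sphere_inner f h"
  unfolding sphere_inner_def by (simp add: mult.assoc)

lemma sphere_inner_sum:
  assumes "finite I" "\<And>i. i \<in> I \<Longrightarrow> cont_sphere (f i)" "cont_sphere h"
  shows "sphere_inner (\<lambda>x. \<Sum>i\<in>I. f i x) h = (\<Sum>i\<in>I. sphere_inner (f i) h)"
  unfolding sphere_inner_def using assms
  by (simp add: sum_distrib_right continuous_on_sphere_integrable continuous_on_mult)

lemma sphere_inner_nonneg: "0 \<le> sphere_inner f f"
  unfolding sphere_inner_def by simp

lemma sphere_inner_Cauchy_Schwarz:
  assumes "cont_sphere f" "cont_sphere g"
  shows "(sphere_inner f g)\<^sup>2 \<le> sphere_inner f f * sphere_inner g g"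
proof -
  have expand: "0 \<le> sphere_inner f f - 2 * s * sphere_inner f g + s\<^sup>2 * sphere_inner g g" for s
  proof -
    define h where "h x = f x - s * g x" for x
    have ch: "cont_sphere h" "cont_sphere (\<lambda>x. s * g x)"
      unfolding h_def by (intro continuous_intros assms)+
    have h: "sphere_inner h k = sphere_inner f k - s * sphere_inner g k" if "cont_sphere k" for k
      unfolding h_def using assms ch that by (simp add: sphere_inner_diff sphere_inner_cmult)
    have "sphere_inner h h = sphere_inner f f - s * sphere_inner g f - s * (sphere_inner f g - s * sphere_inner g g)"
      unfolding h[OF ch(1)] sphere_inner_commute[of f h] sphere_inner_commute[of g h] h[OF assms(1)] h[OF assms(2)] ..
    then show ?thesis
      using sphere_inner_nonneg[of h] by (simp add: sphere_inner_commute[of g f] power2_eq_square algebra_simps)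
  qed
  show ?thesis
  proof (cases "sphere_inner g g = 0")
    case True
    have "sphere_inner f g = 0"
    proof (rule ccontr)
      assume "sphere_inner f g \<noteq> 0"
      then show False
        using expand[of "(sphere_inner f f + 1) / (2 * sphere_inner f g)"] True by simp
    qed
    then show ?thesis by (simp add: True)
  next
    case False
    then have pos: "sphere_inner g g > 0" using sphere_inner_nonneg[of g] by simp
    have "0 \<le> sphere_inner f f - (sphere_inner f g)\<^sup>2 / sphere_inner g g"
      using expand[of "sphere_inner f g / sphere_inner g g"] False
      by (simp add: power2_eq_square field_simps)
    then show ?thesis
      using pos by (simp add: field_simps)
  qed
qed

lemma sphere_inner_le_norms:
  assumes "cont_sphere f" "cont_sphere g"
  shows "\<bar>sphere_inner f g\<bar> \<le> sqrt (sphere_inner f f) * sqrt (sphere_inner g g)"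
  using sphere_inner_Cauchy_Schwarz[OF assms]
    real_le_rsqrt[of "\<bar>sphere_inner f g\<bar>" "sphere_inner f f * sphere_inner g g"]
  by (simp add: real_sqrt_mult)

lemma spherical_harmonic_bound:
  fixes p :: "'a::euclidean_space \<Rightarrow> real"
  assumes "2 \<le> DIM('a)" and p: "p \<in> spherical_harmonics d" and "norm x = 1"
  shows "\<bar>p x\<bar> \<le> 2 ^ (DIM('a) + d) * sqrt (sphere_inner p p)"
proof -
  have cont: "cont_sphere p"
    using p by (auto simp: spherical_harmonics_iff intro: polynomial_continuous_on)
  have "(LINT y|sphere_measure. \<bar>p y\<bar>) = sphere_inner (\<lambda>y. \<bar>p y\<bar>) (\<lambda>y. 1)"
    by (simp add: sphere_inner_def)
  also have "\<dots> \<le> sqrt (sphere_inner (\<lambda>y. \<bar>p y\<bar>) (\<lambda>y. \<bar>p y\<bar>)) * sqrt (sphere_inner (\<lambda>y::'a. 1) (\<lambda>y. 1))"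
    by (rule order_trans[OF abs_ge_self sphere_inner_le_norms]) (intro continuous_intros cont)+
  also have "\<dots> = sqrt (sphere_inner p p)"
    by (simp add: sphere_inner_def flip: abs_mult)
  finally show ?thesis
    using spherical_harmonic_bound_L1[OF assms]
    by (meson mult_left_mono order_trans zero_le_numeral zero_le_power)
qed

lemma partial_deriv_spherical_harmonic:
  assumes "p \<in> spherical_harmonics d"
  shows "partial_deriv b p \<in> spherical_harmonics (d - 1)"
proof -
  have poly: "real_polynomial_function p" and hom: "homogeneous d p" and lap: "laplacian p x = 0" for x
    using assms by (auto simp: spherical_harmonics_iff)
  have "laplacian (partial_deriv b p) x = partial_deriv b (laplacian p) x" for x
  proof -
    have "partial_deriv c (partial_deriv c (partial_deriv b p)) = partial_deriv b (partial_deriv c (partial_deriv c p))" for c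
      using partial_deriv_commute[OF poly] partial_deriv_commute[OF partial_deriv_polynomial[OF poly]] by metis
    then show ?thesis
      unfolding laplacian_def[abs_def] by (simp add: partial_deriv_sum partial_deriv_polynomial poly)
  qed
  moreover have "laplacian p = (\<lambda>x. 0)" using lap by (rule ext)
  ultimately show ?thesis
    using poly homogeneous_partial_deriv[OF poly hom, of b] by (auto simp: spherical_harmonics_iff)
qed

text \<open>Apply the bound to the partial derivatives, which are homogeneous harmonic polynomials themselves.\<close>

lemma spherical_harmonic_gradient_bound:
  fixes p :: "'a::euclidean_space \<Rightarrow> real"
  assumes n: "2 \<le> DIM('a)" and p: "p \<in> spherical_harmonics d" and "norm x \<le> 2"
  shows "norm (gradient p x) \<le> real DIM('a) * (2 * real d + real DIM('a)) * 2 ^ (DIM('a) + 2 * d) *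
    sqrt (sphere_inner p p)"
proof -
  let ?N = "DIM('a)"
  have poly: "real_polynomial_function p"
    using p by (auto simp: spherical_harmonics_iff)
  have part: "\<bar>partial_deriv b p x\<bar> \<le> (2 * real d + real ?N) * 2 ^ (?N + 2 * d) * sqrt (sphere_inner p p)"
    if b: "b \<in> Basis" for b
  proof -
    let ?q = "partial_deriv b p"
    have q: "?q \<in> spherical_harmonics (d - 1)"
      by (rule partial_deriv_spherical_harmonic[OF p])
    have "sphere_inner ?q ?q \<le> (LINT x|sphere_measure. gradient p x \<bullet> gradient p x)"
      unfolding sphere_inner_def
    proof (rule integral_mono)
      show "?q x * ?q x \<le> gradient p x \<bullet> gradient p x" for x
      proof -
        have "(\<bar>gradient p x \<bullet> b\<bar>)\<^sup>2 \<le> (norm (gradient p x))\<^sup>2"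
          by (rule power_mono[OF Basis_le_norm[OF b]]) simp
        then show ?thesis
          by (simp only: gradient_inner_Basis[OF b] power2_norm_eq_inner power2_abs
              power2_eq_square[of "partial_deriv b p x"])
      qed
    qed (intro continuous_on_sphere_integrable continuous_intros polynomial_continuous_on
        partial_deriv_polynomial polynomial_gradient_continuous_on poly)+
    also have "\<dots> \<le> (2 * real d + real ?N)\<^sup>2 * sphere_inner p p"
      unfolding integral_gradient_squared[OF p] sphere_inner_def[symmetric]
    proof (intro mult_right_mono sphere_inner_nonneg)
      have "real d * (real ?N + 2 * real d - 2) \<le> (2 * real d + real ?N) * (2 * real d + real ?N)"
        using n by (intro mult_mono) auto
      then show "real d * (real ?N + 2 * real d - 2) \<le> (2 * real d + real ?N)\<^sup>2"
        by (simp add: power2_eq_square)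
    qed
    finally have q_norm: "sqrt (sphere_inner ?q ?q) \<le> (2 * real d + real ?N) * sqrt (sphere_inner p p)"
      by (simp add: real_le_lsqrt power_mult_distrib sphere_inner_nonneg)
    have "\<exists>u. norm u = 1 \<and> x = norm x *\<^sub>R u"
    proof (cases "x = 0")
      case True
      then show ?thesis using norm_Basis[OF b] by (intro exI[where x = b]) simp
    next
      case False
      then show ?thesis by (intro exI[where x = "sgn x"]) (simp add: norm_sgn sgn_div_norm)
    qed
    then obtain u where u: "norm u = 1" "x = norm x *\<^sub>R u" by blast
    have "\<bar>?q x\<bar> = norm x ^ (d - 1) * \<bar>?q u\<bar>"
      using q by (subst u(2)) (simp add: spherical_harmonics_iff homogeneousD[of "d - 1"] abs_mult)
    also have "\<dots> \<le> 2 ^ (d - 1) * (2 ^ (?N + (d - 1)) * sqrt (sphere_inner ?q ?q))"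
      by (intro mult_mono power_mono assms spherical_harmonic_bound[OF n q u(1)]) auto
    also have "\<dots> \<le> 2 ^ d * (2 ^ (?N + d) * ((2 * real d + real ?N) * sqrt (sphere_inner p p)))"
      by (intro mult_mono power_increasing q_norm) (auto simp: sphere_inner_nonneg)
    also have "\<dots> = (2 * real d + real ?N) * 2 ^ (?N + 2 * d) * sqrt (sphere_inner p p)"
    proof -
      have "(2::real) ^ (2 * d) = 2 ^ d * 2 ^ d" by (simp add: power_add mult_2)
      then show ?thesis by (simp add: power_add)
    qed
    finally show ?thesis .
  qed
  have "norm (gradient p x) \<le> (\<Sum>b\<in>Basis. \<bar>gradient p x \<bullet> b\<bar>)"
    by (rule norm_le_l1)
  also have "\<dots> \<le> (\<Sum>b\<in>(Basis::'a set). (2 * real d + real ?N) * 2 ^ (?N + 2 * d) * sqrt (sphere_inner p p))"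
    by (intro sum_mono) (simp only: gradient_inner_Basis part)
  finally show ?thesis by (simp add: mult.assoc)
qed

section \<open>Expansion in spherical harmonics\<close>

text \<open>
  One step of the Gram-Schmidt process per function.
\<close>

lemma finite_orthogonal_projection:
  fixes g :: "'a::euclidean_space \<Rightarrow> real"
  assumes "finite I" "\<And>i. i \<in> I \<Longrightarrow> cont_sphere (b i)" "cont_sphere g"
  shows "\<exists>c. \<forall>i\<in>I. sphere_inner (\<lambda>x. g x - (\<Sum>j\<in>I. c j * b j x)) (b i) = 0"
  using assms
proof (induction I arbitrary: g rule: finite_induct)
  case (insert k I)
  note cont_b = insert.prems(1) and cont_g = insert.prems(2)
  obtain a where a: "\<And>i. i \<in> I \<Longrightarrow> sphere_inner (\<lambda>x. b k x - (\<Sum>j\<in>I. a j * b j x)) (b i) = 0"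
    using insert.IH[of "b k"] cont_b by blast
  obtain c where c: "\<And>i. i \<in> I \<Longrightarrow> sphere_inner (\<lambda>x. g x - (\<Sum>j\<in>I. c j * b j x)) (b i) = 0"
    using insert.IH[of g] cont_b cont_g by blast
  define w where "w x = b k x - (\<Sum>j\<in>I. a j * b j x)" for x
  define h where "h x = g x - (\<Sum>j\<in>I. c j * b j x)" for x
  have cont_comb: "cont_sphere (\<lambda>x. \<Sum>j\<in>I. e j * b j x)" for e
    using cont_b by (intro continuous_intros) auto
  have cont_k: "cont_sphere (b k)" using cont_b by simp
  have cont: "cont_sphere w" "cont_sphere h"
    unfolding w_def h_def by (intro continuous_intros cont_comb cont_g cont_k)+
  \<comment> \<open>If \<open>w\<close> vanishes almost everywhere, then \<open>s = 0\<close> by division by zero, and any \<open>s\<close> would do.\<close>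
  define s where "s = sphere_inner h w / sphere_inner w w"
  define r where "r x = h x - s * w x" for x
  have cont_r: "cont_sphere r"
    unfolding r_def by (intro continuous_intros cont)
  have r_inner: "sphere_inner r v = sphere_inner h v - s * sphere_inner w v" if "cont_sphere v" for v
    unfolding r_def using cont that by (simp add: sphere_inner_diff sphere_inner_cmult continuous_on_mult)
  have r_I: "sphere_inner r (b i) = 0" if "i \<in> I" for i
    using a[OF that] c[OF that] cont_b that by (simp add: r_inner flip: w_def h_def)
  have "sphere_inner r w = 0"
  proof (cases "sphere_inner w w = 0")
    case True
    then have "sphere_inner h w = 0"
      using sphere_inner_Cauchy_Schwarz[OF cont(2,1)] by simp
    then show ?thesis by (simp add: r_inner cont True)
  qed (simp add: r_inner cont s_def)
  have r_k: "sphere_inner r (b k) = 0"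
  proof -
    have "sphere_inner r (b k) = sphere_inner (\<lambda>x. w x + (\<Sum>j\<in>I. a j * b j x)) r"
      unfolding w_def by (simp add: sphere_inner_commute[of r])
    also have "\<dots> = sphere_inner w r + (\<Sum>j\<in>I. a j * sphere_inner (b j) r)"
      using cont_b insert.hyps cont cont_r cont_comb
      by (simp add: sphere_inner_add sphere_inner_sum sphere_inner_cmult continuous_on_mult)
    finally show ?thesis
      using \<open>sphere_inner r w = 0\<close> r_I by (simp add: sphere_inner_commute[of _ r])
  qed
  define e where "e j = (if j = k then s else c j - s * a j)" for j
  have "r = (\<lambda>x. g x - (\<Sum>j\<in>insert k I. e j * b j x))"
  proof
    fix x
    have "(\<Sum>j\<in>insert k I. e j * b j x) = s * b k x + (\<Sum>j\<in>I. (c j - s * a j) * b j x)"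
      using insert.hyps by (simp add: e_def) (intro sum.cong, auto)
    then show "r x = g x - (\<Sum>j\<in>insert k I. e j * b j x)"
      by (simp add: r_def h_def w_def algebra_simps sum_subtractf sum_distrib_left)
  qed
  with r_I r_k show ?case by (intro exI[where x = e]) auto
qed simp

lemma monomial_combination_orthogonal:
  assumes "cont_sphere h" "\<And>t. t \<in> set ts \<Longrightarrow> sphere_inner h (monomial (snd t)) = 0"
  shows "sphere_inner h (monomial_combination ts) = 0"
  using assms(2)
proof (induction ts)
  case Nil
  then show ?case by (simp add: sphere_inner_def)
next
  case (Cons t ts)
  obtain a l where t: "t = (a, l)" by fastforce
  have "sphere_inner (monomial_combination (t # ts)) h =
      a * sphere_inner (monomial l) h + sphere_inner (monomial_combination ts) h"
    unfolding t monomial_combination_simps(2)[abs_def]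
    using assms(1) monomial_polynomial[of l] monomial_combination_polynomial[of ts]
    by (simp add: sphere_inner_add sphere_inner_cmult continuous_on_mult polynomial_continuous_on)
  moreover have "sphere_inner (monomial l) h = 0"
    using Cons.prems[of t] by (simp add: t sphere_inner_commute[of _ h])
  ultimately show ?case
    using Cons t unfolding sphere_inner_commute[of h] by (simp del: monomial_combination_simps)
qed

lemma spherical_harmonics_cont: "p \<in> spherical_harmonics d \<Longrightarrow> cont_sphere p"
  by (auto simp: spherical_harmonics_iff intro: polynomial_continuous_on)

context
  assumes dim: "2 \<le> DIM('a::euclidean_space)"
begin

lemma spherical_harmonics_inner_zero:
  fixes F G :: "'a \<Rightarrow> real"
  shows "F \<in> spherical_harmonics d \<Longrightarrow> G \<in> spherical_harmonics e \<Longrightarrow> d \<noteq> e \<Longrightarrow> sphere_inner F G = 0"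
  unfolding sphere_inner_def by (rule spherical_harmonics_orthogonal[OF dim])

text \<open>
  Project onto the homogeneous polynomials of degree \<open>d\<close>, which are spanned by finitely many monomials,
  and keep from the decomposition of the result the term of degree \<open>d\<close>: the other terms are orthogonal
  to the harmonics of degree \<open>d\<close>.
\<close>

lemma harmonic_projection_exists:
  fixes g :: "'a \<Rightarrow> real"
  assumes g: "cont_sphere g"
  shows "\<exists>F\<in>spherical_harmonics d. \<forall>v\<in>spherical_harmonics d. sphere_inner F v = sphere_inner g v"
proof -
  define I where "I = {l :: 'a list. set l \<subseteq> Basis \<and> length l = d}"
  have I: "finite I" unfolding I_def by (rule finite_lists_length_eq) simp
  obtain c where c: "\<And>l. l \<in> I \<Longrightarrow> sphere_inner (\<lambda>x. g x - (\<Sum>l\<in>I. c l * monomial l x)) (monomial l) = 0"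
    using finite_orthogonal_projection[OF I, of monomial g] g
    by (auto intro: polynomial_continuous_on monomial_polynomial)
  define q where "q x = (\<Sum>l\<in>I. c l * monomial l x)" for x
  have q_poly: "real_polynomial_function q"
    unfolding q_def using I
    by (intro real_polynomial_function_sum real_polynomial_function.intros(2,4) monomial_polynomial) auto
  have q_hom: "homogeneous d q"
    unfolding q_def
  proof (intro homogeneous_sum homogeneous_cmult)
    fix l :: "'a list"
    assume "l \<in> I"
    then show "homogeneous d (monomial l)"
      using homogeneous_monomial[of l] by (simp add: I_def)
  qed
  obtain w where w: "\<And>j. w j \<in> spherical_harmonics (d - 2 * j)"
    and q: "q = (\<lambda>x. \<Sum>j\<le>d div 2. (x \<bullet> x) ^ j * w j x)"
    using harmonic_decomposition[OF q_poly q_hom] by blast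
  have "sphere_inner (w 0) v = sphere_inner g v" if v: "v \<in> spherical_harmonics d" for v
  proof -
    obtain ts where ts: "\<And>t. t \<in> set ts \<Longrightarrow> set (snd t) \<subseteq> Basis \<and> length (snd t) = d"
      and v_eq: "v = monomial_combination ts"
      using homogeneous_polynomial_monomials[of v d] v by (auto simp: spherical_harmonics_iff)
    have "sphere_inner (\<lambda>x. g x - q x) v = 0"
      unfolding v_eq
    proof (rule monomial_combination_orthogonal)
      show "cont_sphere (\<lambda>x. g x - q x)"
        by (intro continuous_intros g polynomial_continuous_on q_poly)
      show "sphere_inner (\<lambda>x. g x - q x) (monomial (snd t)) = 0" if "t \<in> set ts" for t
        using c[of "snd t"] ts[OF that] by (simp add: I_def q_def)
    qed
    then have "sphere_inner g v = sphere_inner q v"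
      by (simp add: sphere_inner_diff g polynomial_continuous_on q_poly spherical_harmonics_cont[OF v])
    also have "\<dots> = sphere_inner (\<lambda>x. \<Sum>j\<le>d div 2. w j x) v"
      by (rule sphere_inner_cong) (simp_all add: q dot_square_norm)
    also have "\<dots> = (\<Sum>j\<le>d div 2. sphere_inner (w j) v)"
      using w v by (intro sphere_inner_sum) (auto intro: spherical_harmonics_cont)
    also have "\<dots> = (\<Sum>j\<in>{0}. sphere_inner (w j) v)"
    proof (rule sum.mono_neutral_right)
      show "\<forall>j\<in>{..d div 2} - {0}. sphere_inner (w j) v = 0"
      proof
        fix j
        assume "j \<in> {..d div 2} - {0}"
        then have "d - 2 * j \<noteq> d" by auto
        then show "sphere_inner (w j) v = 0"
          by (rule spherical_harmonics_inner_zero[OF w v])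
      qed
    qed auto
    finally show ?thesis by simp
  qed
  moreover have "w 0 \<in> spherical_harmonics d" using w[of 0] by simp
  ultimately show ?thesis by blast
qed

text \<open>
  The sum may be extended to any \<open>M \<ge> N\<close>, so that the sums for different functions can be taken over
  a common range.
\<close>

definition sum_of_harmonics :: "('a \<Rightarrow> real) \<Rightarrow> bool" where
  "sum_of_harmonics q \<longleftrightarrow> (\<exists>h N. (\<forall>d. h d \<in> spherical_harmonics d) \<and>
     (\<forall>M\<ge>N. \<forall>x. norm x = 1 \<longrightarrow> q x = (\<Sum>d<M. h d x)))"

lemma sum_of_harmonics_add:
  assumes "sum_of_harmonics p" "sum_of_harmonics q"
  shows "sum_of_harmonics (\<lambda>x. p x + q x)"
proof -
  obtain h N h' N' where "\<forall>d. h d \<in> spherical_harmonics d" "\<forall>d. h' d \<in> spherical_harmonics d"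
     "\<forall>M\<ge>N. \<forall>x. norm x = 1 \<longrightarrow> p x = (\<Sum>d<M. h d x)"
     "\<forall>M\<ge>N'. \<forall>x. norm x = 1 \<longrightarrow> q x = (\<Sum>d<M. h' d x)"
    using assms unfolding sum_of_harmonics_def by blast
  then show ?thesis
    unfolding sum_of_harmonics_def
    by (intro exI[where x = "\<lambda>d x. h d x + h' d x"] exI[where x = "max N N'"])
       (auto simp: sum.distrib intro: spherical_harmonics_add)
qed

lemma sum_of_harmonics_harmonic:
  assumes "w \<in> spherical_harmonics k" "\<And>x. norm x = 1 \<Longrightarrow> q x = w x"
  shows "sum_of_harmonics q"
proof -
  have "(\<Sum>d<M. (if d = k then w else (\<lambda>x. 0)) x) = w x" if "Suc k \<le> M" for M x
  proof -
    have "(\<Sum>d<M. (if d = k then w else (\<lambda>x. 0)) x) = (\<Sum>d<M. if d = k then w x else 0)"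
      by (intro sum.cong) auto
    then show ?thesis using that by simp
  qed
  then show ?thesis
    unfolding sum_of_harmonics_def using assms
    by (intro exI[where x = "\<lambda>d. if d = k then w else (\<lambda>x. 0)"] exI[where x = "Suc k"])
       (auto intro: spherical_harmonics_zero)
qed

lemma sum_of_harmonics_sum:
  "finite I \<Longrightarrow> (\<And>i. i \<in> I \<Longrightarrow> sum_of_harmonics (p i)) \<Longrightarrow> sum_of_harmonics (\<lambda>x. \<Sum>i\<in>I. p i x)"
proof (induction I rule: finite_induct)
  case empty
  show ?case by (simp, rule sum_of_harmonics_harmonic[OF spherical_harmonics_zero[of 0]]) simp
next
  case (insert i I)
  then show ?case by (simp add: sum_of_harmonics_add)
qed

lemma polynomial_sum_of_harmonics:
  fixes p :: "'a \<Rightarrow> real"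
  assumes "real_polynomial_function p"
  shows "sum_of_harmonics p"
proof -
  obtain P D where P: "\<And>k. real_polynomial_function (P k)" "\<And>k. homogeneous k (P k)"
    and p: "p = (\<lambda>x. \<Sum>k\<le>D. P k x)"
    using polynomial_homogeneous_components[OF assms] by metis
  have "sum_of_harmonics (P k)" for k
  proof -
    obtain w where w: "\<And>j. w j \<in> spherical_harmonics (k - 2 * j)"
      and Pk: "P k = (\<lambda>x. \<Sum>j\<le>k div 2. (x \<bullet> x) ^ j * w j x)"
      using harmonic_decomposition[OF P] by blast
    show ?thesis
      unfolding Pk
      by (intro sum_of_harmonics_sum sum_of_harmonics_harmonic[OF w]) (auto simp: dot_square_norm)
  qed
  then show ?thesis
    unfolding p by (intro sum_of_harmonics_sum) auto
qed

lemma inner_harmonic_sum: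
  fixes F :: "nat \<Rightarrow> 'a \<Rightarrow> real"
  assumes "\<And>d. F d \<in> spherical_harmonics d" and v: "v \<in> spherical_harmonics d"
  shows "sphere_inner (\<lambda>x. \<Sum>e<N. F e x) v = (if d < N then sphere_inner (F d) v else 0)"
proof -
  have "sphere_inner (\<lambda>x. \<Sum>e<N. F e x) v = (\<Sum>e<N. sphere_inner (F e) v)"
    using assms by (intro sphere_inner_sum) (auto intro: spherical_harmonics_cont)
  also have "\<dots> = (\<Sum>e<N. if e = d then sphere_inner (F d) v else 0)"
    using spherical_harmonics_inner_zero[OF assms(1) v] by (intro sum.cong) auto
  finally show ?thesis by simp
qed

text \<open>
  Pythagoras: \<open>g - \<Sum> F d\<close> is orthogonal to all harmonics of degree less than \<open>N\<close>.
\<close>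

lemma best_approximation:
  fixes g :: "'a \<Rightarrow> real"
  assumes g: "cont_sphere g"
    and F: "\<And>d. F d \<in> spherical_harmonics d" "\<And>d v. v \<in> spherical_harmonics d \<Longrightarrow> sphere_inner (F d) v = sphere_inner g v"
    and h: "\<And>d. h d \<in> spherical_harmonics d"
  shows "sphere_inner (\<lambda>x. g x - (\<Sum>d<N. F d x)) (\<lambda>x. g x - (\<Sum>d<N. F d x)) \<le>
    sphere_inner (\<lambda>x. g x - (\<Sum>d<N. h d x)) (\<lambda>x. g x - (\<Sum>d<N. h d x))"
proof -
  define r where "r x = g x - (\<Sum>d<N. F d x)" for x
  define s where "s x = (\<Sum>d<N. F d x - h d x)" for x
  have FN: "cont_sphere (\<lambda>x. \<Sum>d<N. F d x)"
    by (intro continuous_intros spherical_harmonics_cont[OF F(1)])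
  have cont: "cont_sphere r" "cont_sphere s"
    unfolding r_def s_def
    by (intro continuous_intros g spherical_harmonics_cont[OF F(1)] spherical_harmonics_cont[OF h])+
  have "sphere_inner (\<lambda>x. F d x - h d x) r = 0" if "d < N" for d
  proof -
    have d: "(\<lambda>x. F d x - h d x) \<in> spherical_harmonics d"
      by (intro spherical_harmonics_diff F h)
    then show ?thesis
      unfolding sphere_inner_commute[of _ r]
      unfolding r_def using that F(2)[OF d] inner_harmonic_sum[OF F(1) d, of N]
      by (simp add: sphere_inner_diff g FN spherical_harmonics_cont[OF d])
  qed
  then have "sphere_inner s r = 0"
    unfolding s_def using cont(1)
    by (subst sphere_inner_sum) (auto intro!: continuous_intros spherical_harmonics_cont[OF F(1)] spherical_harmonics_cont[OF h])
  have add: "sphere_inner (\<lambda>x. r x + s x) k = sphere_inner r k + sphere_inner s k" if "cont_sphere k" for k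
    using cont that by (rule sphere_inner_add)
  have "sphere_inner (\<lambda>x. r x + s x) (\<lambda>x. r x + s x) =
      sphere_inner r (\<lambda>x. r x + s x) + sphere_inner s (\<lambda>x. r x + s x)"
    by (intro add continuous_intros cont)
  also have "\<dots> = sphere_inner r r + sphere_inner s s"
    using \<open>sphere_inner s r = 0\<close> cont
    by (simp add: sphere_inner_commute[of r "\<lambda>x. r x + s x"] sphere_inner_commute[of s "\<lambda>x. r x + s x"]
        sphere_inner_commute[of r s] add)
  finally have "sphere_inner r r \<le> sphere_inner (\<lambda>x. r x + s x) (\<lambda>x. r x + s x)"
    using sphere_inner_nonneg[of s] by simp
  moreover have "(\<lambda>x. r x + s x) = (\<lambda>x. g x - (\<Sum>d<N. h d x))"
    by (simp add: r_def s_def sum_subtractf)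
  ultimately show ?thesis unfolding r_def by simp
qed

lemma is_harmonic_expansion_iff:
  fixes g :: "'a \<Rightarrow> real"
  assumes g: "cont_sphere g"
  shows "is_harmonic_expansion g F \<longleftrightarrow> (\<forall>d. F d \<in> spherical_harmonics d) \<and>
    (\<lambda>N. sphere_inner (\<lambda>x. g x - (\<Sum>d<N. F d x)) (\<lambda>x. g x - (\<Sum>d<N. F d x))) \<longlonglongrightarrow> 0"
proof -
  have "(\<integral>\<^sup>+ x. ennreal ((g x - (\<Sum>d<N. F d x))\<^sup>2) \<partial>sphere_measure) =
      ennreal (sphere_inner (\<lambda>x. g x - (\<Sum>d<N. F d x)) (\<lambda>x. g x - (\<Sum>d<N. F d x)))"
    if F: "\<forall>d. F d \<in> spherical_harmonics d" for N
    unfolding sphere_inner_def power2_eq_square using F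
    by (intro nn_integral_eq_integral continuous_on_sphere_integrable continuous_intros g
        spherical_harmonics_cont[OF F[rule_format]]) auto
  then show ?thesis
    unfolding is_harmonic_expansion_def
    by (auto simp: tendsto_ennreal_iff[of _ _ 0, simplified] sphere_inner_nonneg)
qed

text \<open>
  By the best approximation property, the partial sums of the projections approximate \<open>g\<close> in \<open>L\<^sup>2\<close> at least as well
  as the polynomials of Weierstrass's theorem.
\<close>

lemma harmonic_expansion_exists:
  fixes g :: "'a \<Rightarrow> real"
  assumes g: "cont_sphere g"
  shows "\<exists>F. is_harmonic_expansion g F"
proof -
  obtain F where F: "\<And>d. F d \<in> spherical_harmonics d"
    "\<And>d v. v \<in> spherical_harmonics d \<Longrightarrow> sphere_inner (F d) v = sphere_inner g v"
    using harmonic_projection_exists[OF g] by metis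
  have "(\<lambda>N. sphere_inner (\<lambda>x. g x - (\<Sum>d<N. F d x)) (\<lambda>x. g x - (\<Sum>d<N. F d x))) \<longlonglongrightarrow> 0"
  proof (rule LIMSEQ_I)
    fix e :: real
    assume e: "e > 0"
    define \<delta> where "\<delta> = sqrt (e / 2)"
    have \<delta>: "\<delta> > 0" "\<delta> * \<delta> = e / 2" using e by (simp_all add: \<delta>_def)
    obtain p where p: "real_polynomial_function p" "\<And>x. x \<in> sphere 0 1 \<Longrightarrow> \<bar>g x - p x\<bar> < \<delta>"
      using Stone_Weierstrass_real_polynomial_function[OF compact_sphere g \<delta>(1)] by blast
    obtain h N where h: "\<And>d. h d \<in> spherical_harmonics d"
      "\<And>M x. M \<ge> N \<Longrightarrow> norm x = 1 \<Longrightarrow> p x = (\<Sum>d<M. h d x)"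
      using polynomial_sum_of_harmonics[OF p(1)] unfolding sum_of_harmonics_def by blast
    have gp: "sphere_inner (\<lambda>x. g x - p x) (\<lambda>x. g x - p x) \<le> \<delta> * \<delta>"
    proof -
      have "sphere_inner (\<lambda>x. g x - p x) (\<lambda>x. g x - p x) \<le> (LINT x|(sphere_measure :: 'a measure). \<delta> * \<delta>)"
        unfolding sphere_inner_def
      proof (rule integral_mono)
        show "(g x - p x) * (g x - p x) \<le> \<delta> * \<delta>" if "x \<in> space sphere_measure" for x
          using mult_mono[of "\<bar>g x - p x\<bar>" \<delta> "\<bar>g x - p x\<bar>" \<delta>] p(2)[of x] that \<delta>(1)
          by (simp flip: abs_mult)
      qed (intro continuous_on_sphere_integrable continuous_intros g polynomial_continuous_on p(1))+
      then show ?thesis by simp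
    qed
    have "norm (sphere_inner (\<lambda>x. g x - (\<Sum>d<M. F d x)) (\<lambda>x. g x - (\<Sum>d<M. F d x)) - 0) < e"
      if "N \<le> M" for M
    proof -
      have "sphere_inner (\<lambda>x. g x - (\<Sum>d<M. F d x)) (\<lambda>x. g x - (\<Sum>d<M. F d x)) \<le>
          sphere_inner (\<lambda>x. g x - (\<Sum>d<M. h d x)) (\<lambda>x. g x - (\<Sum>d<M. h d x))"
        by (rule best_approximation[OF g F h(1)])
      also have "\<dots> = sphere_inner (\<lambda>x. g x - p x) (\<lambda>x. g x - p x)"
        by (rule sphere_inner_cong) (simp_all add: h(2)[OF that])
      finally show ?thesis
        using gp \<delta> e sphere_inner_nonneg[of "\<lambda>x. g x - (\<Sum>d<M. F d x)"] by simp
    qed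
    then show "\<exists>no. \<forall>M\<ge>no. norm (sphere_inner (\<lambda>x. g x - (\<Sum>d<M. F d x)) (\<lambda>x. g x - (\<Sum>d<M. F d x)) - 0) < e"
      by blast
  qed
  with F(1) show ?thesis
    using is_harmonic_expansion_iff[OF g] by blast
qed

lemma harmonic_expansion_inner:
  fixes g :: "'a \<Rightarrow> real"
  assumes g: "cont_sphere g" and F: "is_harmonic_expansion g F" and f: "cont_sphere f"
  shows "(\<lambda>N. sphere_inner f (\<lambda>x. \<Sum>d<N. F d x)) \<longlonglongrightarrow> sphere_inner f g"
proof -
  define r where "r N x = g x - (\<Sum>d<N. F d x)" for N x
  have lim: "(\<lambda>N. sphere_inner (r N) (r N)) \<longlonglongrightarrow> 0" and Fd: "\<And>d. F d \<in> spherical_harmonics d"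
    using F is_harmonic_expansion_iff[OF g] unfolding r_def by auto
  have cF: "cont_sphere (\<lambda>x. \<Sum>d<N. F d x)" for N
    by (intro continuous_intros spherical_harmonics_cont[OF Fd])
  have cr: "cont_sphere (r N)" for N
    unfolding r_def by (intro continuous_intros g cF)
  have "(\<lambda>N. sphere_inner (r N) f) \<longlonglongrightarrow> 0"
  proof (rule Lim_null_comparison)
    show "\<forall>\<^sub>F N in sequentially. norm (sphere_inner (r N) f) \<le>
        sqrt (sphere_inner (r N) (r N)) * sqrt (sphere_inner f f)"
      using sphere_inner_le_norms[OF cr f] by simp
    show "(\<lambda>N. sqrt (sphere_inner (r N) (r N)) * sqrt (sphere_inner f f)) \<longlonglongrightarrow> 0"
      using tendsto_mult_left_zero[OF tendsto_real_sqrt[OF lim, simplified]] .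
  qed
  moreover have "sphere_inner (r N) f = sphere_inner f g - sphere_inner f (\<lambda>x. \<Sum>d<N. F d x)" for N
    unfolding r_def using g cF f by (simp add: sphere_inner_diff sphere_inner_commute[of f])
  ultimately have "(\<lambda>N. sphere_inner f g - (sphere_inner f g - sphere_inner f (\<lambda>x. \<Sum>d<N. F d x)))
      \<longlonglongrightarrow> sphere_inner f g - 0"
    by (intro tendsto_diff tendsto_const) simp
  then show ?thesis by simp
qed

text \<open>
  By orthogonality, \<open>\<langle>F d, v\<rangle>\<close> is the inner product of \<open>v\<close> with every late enough partial sum. This characterises
  \<open>F d\<close> among the harmonics of degree \<open>d\<close>.
\<close>

lemma harmonic_expansion_component:
  fixes g :: "'a \<Rightarrow> real"
  assumes g: "cont_sphere g" and F: "is_harmonic_expansion g F" and v: "v \<in> spherical_harmonics d"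
  shows "sphere_inner (F d) v = sphere_inner g v"
proof -
  have Fd: "\<And>d. F d \<in> spherical_harmonics d"
    using F by (simp add: is_harmonic_expansion_def)
  have "(\<lambda>N. sphere_inner v (\<lambda>x. \<Sum>e<N. F e x)) \<longlonglongrightarrow> sphere_inner v g"
    by (rule harmonic_expansion_inner[OF g F spherical_harmonics_cont[OF v]])
  moreover have "\<forall>\<^sub>F N in sequentially. sphere_inner v (\<lambda>x. \<Sum>e<N. F e x) = sphere_inner (F d) v"
    using eventually_gt_at_top[of d]
  proof eventually_elim
    case (elim N)
    then show ?case
      using inner_harmonic_sum[OF Fd v, of N] by (simp add: sphere_inner_commute[of v])
  qed
  ultimately have "(\<lambda>N. sphere_inner (F d) v) \<longlonglongrightarrow> sphere_inner v g"
    by (rule Lim_transform_eventually)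
  then show ?thesis
    by (simp add: LIMSEQ_const_iff sphere_inner_commute[of v])
qed

lemma spherical_harmonic_eq_zero:
  assumes v: "v \<in> spherical_harmonics d" and "sphere_inner v v = 0"
  shows "v = (\<lambda>x::'a. 0)"
proof
  fix x :: 'a
  obtain b :: 'a where b: "b \<in> Basis" using nonempty_Basis by blast
  define u where "u = (if x = 0 then b else sgn x)"
  have u: "norm u = 1" "x = norm x *\<^sub>R u"
    using b by (auto simp: u_def norm_sgn sgn_div_norm)
  have "v u = 0"
    using spherical_harmonic_bound[OF dim v u(1)] assms(2) by simp
  moreover have "v x = norm x ^ d * v u"
    by (subst u(2)) (use v in \<open>simp add: spherical_harmonics_iff homogeneousD\<close>)
  ultimately show "v x = 0" by simp
qed

lemma harmonic_expansion_unique: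
  fixes g :: "'a \<Rightarrow> real"
  assumes g: "cont_sphere g" and F: "is_harmonic_expansion g F" and G: "is_harmonic_expansion g G"
  shows "F = G"
proof
  fix d
  have "F d \<in> spherical_harmonics d" "G d \<in> spherical_harmonics d"
    using F G by (simp_all add: is_harmonic_expansion_def)
  then have v: "(\<lambda>x. F d x - G d x) \<in> spherical_harmonics d"
    and c: "cont_sphere (F d)" "cont_sphere (G d)"
    by (auto intro: spherical_harmonics_diff spherical_harmonics_cont)
  have "sphere_inner (\<lambda>x. F d x - G d x) (\<lambda>x. F d x - G d x) = 0"
    by (subst sphere_inner_diff[OF c spherical_harmonics_cont[OF v]])
       (simp add: harmonic_expansion_component[OF g F v] harmonic_expansion_component[OF g G v])
  from spherical_harmonic_eq_zero[OF v this] show "F d = G d"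
    by (simp add: fun_eq_iff)
qed

subsection \<open>The components of a continuous function\<close>

context
  fixes g :: "'a \<Rightarrow> real"
  assumes g: "cont_sphere g"
begin

lemma harmonic_component_expansion: "is_harmonic_expansion g (harmonic_component g)"
  unfolding harmonic_component_def
  by (rule theI'[where P = "is_harmonic_expansion g"]) (use harmonic_expansion_exists[OF g] harmonic_expansion_unique[OF g] in blast)

lemma harmonic_component_harmonic: "harmonic_component g d \<in> spherical_harmonics d"
  using harmonic_component_expansion by (simp add: is_harmonic_expansion_def)

lemmas harmonic_component_cont = spherical_harmonics_cont[OF harmonic_component_harmonic]
lemmas harmonic_component_inner = harmonic_expansion_component[OF g harmonic_component_expansion]

text \<open>
  The hypothesis says that \<open>g - h\<close> is orthogonal to \<open>h\<close>.
\<close>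

lemma inner_self_le_of_projection:
  assumes "cont_sphere h" "sphere_inner h h = sphere_inner g h"
  shows "sphere_inner h h \<le> sphere_inner g g"
proof (cases "sphere_inner h h = 0")
  case False
  then have "sphere_inner h h > 0" using sphere_inner_nonneg[of h] by simp
  moreover have "sphere_inner h h * sphere_inner h h \<le> sphere_inner g g * sphere_inner h h"
    using sphere_inner_Cauchy_Schwarz[OF g assms(1)] assms(2) by (simp add: power2_eq_square)
  ultimately show ?thesis by simp
qed (simp add: sphere_inner_nonneg)

lemma harmonic_component_norm_le:
  "sphere_inner (harmonic_component g d) (harmonic_component g d) \<le> sphere_inner g g"
  by (intro inner_self_le_of_projection harmonic_component_cont harmonic_component_inner harmonic_component_harmonic)

lemma harmonic_component_sums:
  assumes f: "cont_sphere f"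
  shows "(\<lambda>d. sphere_inner f (harmonic_component g d)) sums sphere_inner f g"
proof -
  have "sphere_inner f (\<lambda>x. \<Sum>d<N. harmonic_component g d x) =
      (\<Sum>d<N. sphere_inner f (harmonic_component g d))" for N
    using f harmonic_component_cont
    by (simp add: sphere_inner_commute[of f] sphere_inner_sum)
  then show ?thesis
    unfolding sums_def
    using harmonic_expansion_inner[OF g harmonic_component_expansion f] by simp
qed

text \<open>
  Changing the signs of the components of \<open>g\<close> does not change the norms of the partial sums, so that signs
  can be chosen which make all the terms nonnegative.
\<close>

lemma harmonic_component_abs_summable:
  assumes f: "cont_sphere f"
  shows "summable (\<lambda>d. \<bar>sphere_inner f (harmonic_component g d)\<bar>)"
proof (rule summableI_nonneg_bounded)
  fix N :: nat
  let ?F = "harmonic_component g"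
  define H where "H s x = (\<Sum>d<N. s d * ?F d x)" for s x
  have H_cont: "cont_sphere (H s)" for s
    unfolding H_def by (intro continuous_intros harmonic_component_cont)
  have H_inner: "sphere_inner (H s) h = (\<Sum>d<N. s d * sphere_inner (?F d) h)" if "cont_sphere h" for s h
    unfolding H_def using that harmonic_component_cont
    by (simp add: sphere_inner_sum sphere_inner_cmult continuous_on_mult)
  have H_self: "sphere_inner (H s) (H s) = (\<Sum>d<N. s d * (s d * sphere_inner (?F d) (?F d)))" for s
  proof -
    have "sphere_inner (H s) (?F d) = (if d < N then s d * sphere_inner (?F d) (?F d) else 0)" for d
      unfolding H_def
      using inner_harmonic_sum[OF spherical_harmonics_cmult[OF harmonic_component_harmonic] harmonic_component_harmonic, of s N d]
      by (simp add: sphere_inner_cmult)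
    then show ?thesis
      unfolding H_inner[OF H_cont] by (simp add: sphere_inner_commute[of _ "H s"])
  qed
  have "sphere_inner (H (\<lambda>d. 1)) (H (\<lambda>d. 1)) = sphere_inner g (H (\<lambda>d. 1))"
    unfolding H_self sphere_inner_commute[of g] H_inner[OF g]
    using harmonic_component_inner[OF harmonic_component_harmonic]
    by (simp add: sphere_inner_commute[of _ g])
  then have le: "sphere_inner (H (\<lambda>d. 1)) (H (\<lambda>d. 1)) \<le> sphere_inner g g"
    by (rule inner_self_le_of_projection[OF H_cont])
  define s where "s d = sgn (sphere_inner f (?F d))" for d
  have "(\<Sum>d<N. \<bar>sphere_inner f (?F d)\<bar>) = sphere_inner (H s) f"
    unfolding H_inner[OF f] s_def by (simp add: abs_sgn mult.commute sphere_inner_commute[of _ f])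
  also have "\<dots> \<le> sqrt (sphere_inner (H s) (H s)) * sqrt (sphere_inner f f)"
    using sphere_inner_le_norms[OF H_cont f, of s] by simp
  also have "sphere_inner (H s) (H s) \<le> sphere_inner (H (\<lambda>d. 1)) (H (\<lambda>d. 1))"
    unfolding H_self by (intro sum_mono) (auto simp: s_def sgn_real_def sphere_inner_nonneg)
  also note le
  finally show "(\<Sum>d<N. \<bar>sphere_inner f (?F d)\<bar>) \<le> sqrt (sphere_inner g g) * sqrt (sphere_inner f f)"
    by (simp add: mult_right_mono sphere_inner_nonneg)
qed simp

end

end

section \<open>The heat semigroup\<close>

abbreviation eigenvalue :: "nat \<Rightarrow> nat \<Rightarrow> real" where
  "eigenvalue n d \<equiv> real d * (real n + real d - 2)"

text \<open>
  Once \<open>d t \<ge> ln 16\<close>, the exponential is at most \<open>(1 / 16)\<^sup>d\<close>, while the second factor grows at most like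
  \<open>2\<^sup>d 4\<^sup>d\<close>.
\<close>

lemma summable_heat_bound:
  assumes "2 \<le> n" "0 < (t::real)"
  shows "summable (\<lambda>d. exp (- (eigenvalue n d * t)) *
    (real n * (2 * real d + real n) * 2 ^ (n + 2 * d)))"
proof (rule summable_comparison_test_ev)
  show "summable (\<lambda>d. real n * (real n + 2) * 2 ^ n * (1 / 2) ^ d :: real)"
    by (intro summable_mult summable_geometric) simp
  have "\<forall>\<^sub>F d in sequentially. ln 16 / t \<le> real d"
    by (rule eventually_ge_at_top[THEN filterlim_iff[THEN iffD1, OF filterlim_real_sequentially, rule_format]])
  then show "\<forall>\<^sub>F d in sequentially. norm (exp (- (eigenvalue n d * t)) *
      (real n * (2 * real d + real n) * 2 ^ (n + 2 * d))) \<le> real n * (real n + 2) * 2 ^ n * (1 / 2) ^ d"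
  proof eventually_elim
    case (elim d)
    have "real d * ln 16 \<le> real d * ((real n + real d - 2) * t)"
    proof (rule mult_left_mono)
      have "ln 16 \<le> real d * t" using elim assms(2) by (simp add: field_simps)
      also have "\<dots> \<le> (real n + real d - 2) * t" using assms by (intro mult_right_mono) auto
      finally show "ln 16 \<le> (real n + real d - 2) * t" .
    qed simp
    then have "exp (- (eigenvalue n d * t)) \<le> exp (real d * - ln 16)"
      by (simp add: mult.assoc)
    also have "\<dots> = (1 / 16) ^ d"
      by (subst exp_of_nat_mult) (simp add: exp_minus inverse_eq_divide)
    finally have 1: "exp (- (eigenvalue n d * t)) \<le> (1 / 16) ^ d" .
    have "1 * real d + real d + real n * 1 \<le> 1 * 2 ^ d + 2 ^ d + real n * 2 ^ d"
      by (intro add_mono mult_left_mono less_imp_le[OF of_nat_less_two_power] one_le_power) auto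
    then have 2: "2 * real d + real n \<le> (real n + 2) * 2 ^ d"
      by (simp add: algebra_simps)
    have "exp (- (eigenvalue n d * t)) * (real n * (2 * real d + real n) * 2 ^ (n + 2 * d))
        \<le> (1 / 16) ^ d * (real n * ((real n + 2) * 2 ^ d) * 2 ^ (n + 2 * d))"
      by (intro mult_mono 1 mult_right_mono mult_left_mono 2) auto
    also have "\<dots> = real n * (real n + 2) * 2 ^ n * ((1 / 16) ^ d * 2 ^ d * (2 ^ 2) ^ d)"
      by (simp only: power_add power_mult) (simp only: mult_ac)
    also have "(1 / 16) ^ d * 2 ^ d * (2 ^ 2) ^ d = (1 / 2 :: real) ^ d"
      by (simp flip: power_mult_distrib)
    finally show ?case by simp
  qed
qed

lemma nn_integral_exponential:
  assumes "(l::real) > 0"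
  shows "(\<integral>\<^sup>+t. ennreal (l * exp (- (l * t))) * indicator {0..} t \<partial>lborel) = 1"
proof -
  have lim: "((\<lambda>t. - exp (- (l * t))) \<longlongrightarrow> - 0) at_top"
    by (intro tendsto_minus filterlim_compose[OF exp_at_bot] filterlim_compose[OF filterlim_uminus_at_bot_at_top]
        filterlim_tendsto_pos_mult_at_top[OF tendsto_const assms] filterlim_ident)
  have "(\<integral>\<^sup>+t. ennreal (l * exp (- (l * t))) * indicator {0..} t \<partial>lborel) =
      ennreal (- 0 - (- exp (- (l * 0))))"
    by (rule nn_integral_FTC_atLeast[OF _ _ _ lim])
       (use assms in \<open>auto intro!: derivative_eq_intros\<close>)
  then show ?thesis by simp
qed

lemma has_bochner_integral_exponential:
  assumes "(l::real) > 0"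
  shows "has_bochner_integral lborel (\<lambda>t. indicator {0..} t * (l * exp (- (l * t)))) 1"
proof (rule has_bochner_integral_nn_integral)
  have "(\<integral>\<^sup>+t. ennreal (indicator {0..} t * (l * exp (- (l * t)))) \<partial>lborel) =
      (\<integral>\<^sup>+t. ennreal (l * exp (- (l * t))) * indicator {0..} t \<partial>lborel)"
    by (intro nn_integral_cong) (auto split: split_indicator)
  then show "(\<integral>\<^sup>+t. ennreal (indicator {0..} t * (l * exp (- (l * t)))) \<partial>lborel) = ennreal 1"
    using nn_integral_exponential[OF assms] by simp
qed (use assms in auto)

context
  fixes g :: "'a::euclidean_space \<Rightarrow> real"
  assumes dim: "2 \<le> DIM('a)" and g: "cont_sphere g"
begin

abbreviation "gc \<equiv> harmonic_component g"

lemma gc: "gc d \<in> spherical_harmonics d"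
  by (rule harmonic_component_harmonic[OF dim g])

lemma gc_polynomial: "real_polynomial_function (gc d)"
  using gc[of d] by (simp add: spherical_harmonics_iff)

definition heat_bound :: "real \<Rightarrow> nat \<Rightarrow> real" where
  "heat_bound t d = exp (- (eigenvalue DIM('a) d * t)) *
     (real DIM('a) * (2 * real d + real DIM('a)) * 2 ^ (DIM('a) + 2 * d)) * sqrt (sphere_inner g g)"

lemma summable_heat_gradient_bound: "0 < t \<Longrightarrow> summable (heat_bound t)"
  unfolding heat_bound_def by (intro summable_mult2 summable_heat_bound dim)

lemma heat_gradient_bound:
  assumes "norm x \<le> 2"
  shows "norm (exp (- (eigenvalue DIM('a) d * t)) *\<^sub>R gradient (gc d) x) \<le> heat_bound t d"
proof -
  have "norm (gradient (gc d) x) \<le>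
      real DIM('a) * (2 * real d + real DIM('a)) * 2 ^ (DIM('a) + 2 * d) * sqrt (sphere_inner (gc d) (gc d))"
    by (rule spherical_harmonic_gradient_bound[OF dim gc assms])
  also have "\<dots> \<le> real DIM('a) * (2 * real d + real DIM('a)) * 2 ^ (DIM('a) + 2 * d) * sqrt (sphere_inner g g)"
    by (intro mult_left_mono real_sqrt_le_mono harmonic_component_norm_le[OF dim g]) auto
  finally show ?thesis
    unfolding heat_bound_def norm_scaleR by (simp add: mult.assoc)
qed

definition heat_gradient :: "real \<Rightarrow> 'a \<Rightarrow> 'a" where
  "heat_gradient t x = (\<Sum>d. exp (- (eigenvalue DIM('a) d * t)) *\<^sub>R gradient (gc d) x)"

lemma heat_gradient_uniform_limit:
  "0 < t \<Longrightarrow> uniform_limit (ball 0 2) (\<lambda>N x. \<Sum>d<N. exp (- (eigenvalue DIM('a) d * t)) *\<^sub>R gradient (gc d) x)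
     (heat_gradient t) sequentially"
  unfolding heat_gradient_def
  by (rule Weierstrass_m_test[OF _ summable_heat_gradient_bound]) (auto simp del: norm_scaleR intro!: heat_gradient_bound)

text \<open>
  The series of the gradients converges uniformly on a convex neighbourhood of the sphere, for which the ball
  of radius 2 is taken.
\<close>

lemma heat_semigroup_has_derivative:
  assumes t: "0 < t" and x: "x \<in> ball 0 2"
  shows "(heat_semigroup t g has_derivative (\<lambda>h. heat_gradient t x \<bullet> h)) (at x)"
proof -
  let ?f = "\<lambda>d x. exp (- (eigenvalue DIM('a) d * t)) * gc d x"
  let ?f' = "\<lambda>d x h. (exp (- (eigenvalue DIM('a) d * t)) *\<^sub>R gradient (gc d) x) \<bullet> h"
  have "\<exists>u. \<forall>x\<in>ball 0 2. (\<lambda>d. ?f d x) sums u x \<and>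
      (u has_derivative (\<lambda>h. heat_gradient t x \<bullet> h)) (at x within ball 0 2)"
  proof (rule has_derivative_series[where f = ?f and f' = ?f' and x = 0 and S = "ball 0 2"
        and g' = "\<lambda>x h. heat_gradient t x \<bullet> h"])
    show "(?f d has_derivative ?f' d x) (at x within ball 0 2)" for d x
      using has_derivative_mult_right[OF has_derivative_at_withinI[OF polynomial_has_derivative[OF gc_polynomial]]]
      by (simp only: inner_scaleR_left)
    \<comment> \<open>At the origin only the constant term of the series is nonzero, so that it converges there trivially.\<close>
    have "gc d 0 = 0" if "d \<noteq> 0" for d
      using gc[of d] that homogeneousD[of d "gc d" 0 0] by (auto simp: spherical_harmonics_iff power_0_left)
    then have "?f d 0 = (if d = 0 then gc 0 0 else 0)" for d
      by simp
    then show "(\<lambda>d. ?f d 0) sums gc 0 0"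
      using sums_If_finite[of "\<lambda>d. d = 0" "\<lambda>d. gc 0 0"] by simp
    show "\<forall>\<^sub>F N in sequentially. \<forall>x\<in>ball 0 2. \<forall>h.
        norm ((\<Sum>d<N. ?f' d x h) - heat_gradient t x \<bullet> h) \<le> e * norm h" if "0 < e" for e
      using uniform_limitD[OF heat_gradient_uniform_limit[OF t] that]
    proof eventually_elim
      case (elim N)
      show ?case
      proof (intro ballI allI)
        fix x h :: 'a
        assume "x \<in> ball 0 2"
        with elim have "norm ((\<Sum>d<N. exp (- (eigenvalue DIM('a) d * t)) *\<^sub>R gradient (gc d) x) - heat_gradient t x) \<le> e"
          by (simp add: dist_norm less_imp_le)
        then have "norm (((\<Sum>d<N. exp (- (eigenvalue DIM('a) d * t)) *\<^sub>R gradient (gc d) x) - heat_gradient t x) \<bullet> h) \<le> e * norm h"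
          by (intro order_trans[OF Cauchy_Schwarz_ineq2[folded real_norm_def]] mult_right_mono) auto
        then show "norm ((\<Sum>d<N. ?f' d x h) - heat_gradient t x \<bullet> h) \<le> e * norm h"
          by (simp only: inner_diff_left inner_sum_left)
      qed
    qed
  qed simp_all
  then obtain u where u: "\<And>x. x \<in> ball 0 2 \<Longrightarrow> (\<lambda>d. ?f d x) sums u x"
    "\<And>x. x \<in> ball 0 2 \<Longrightarrow> (u has_derivative (\<lambda>h. heat_gradient t x \<bullet> h)) (at x within ball 0 2)"
    by blast
  have "u y = heat_semigroup t g y" if "y \<in> ball 0 2" for y
    using sums_unique[OF u(1)[OF that]] t by (simp add: heat_semigroup_def)
  then have "(heat_semigroup t g has_derivative (\<lambda>h. heat_gradient t x \<bullet> h)) (at x within ball 0 2)"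
    using u(2)[OF x] x by (intro has_derivative_transform[OF x _ u(2)[OF x]]) auto
  then show ?thesis
    using x at_within_open[OF x open_ball] by simp
qed

lemma heat_semigroup_C1:
  assumes t: "0 < t"
  shows "C1_on_sphere (heat_semigroup t g)"
proof -
  have "continuous_on (ball 0 2) (heat_gradient t)"
    by (rule uniform_limit_theorem[OF _ heat_gradient_uniform_limit[OF t]])
       (auto intro!: always_eventually continuous_intros polynomial_gradient_continuous_on gc_polynomial)
  then show ?thesis
    unfolding C1_on_sphere_def
    using heat_semigroup_has_derivative[OF t]
    by (intro ballI exI[where x = "ball 0 2"] exI[where x = "heat_semigroup t g"] exI[where x = "heat_gradient t"]) auto
qed

text \<open>Integrate by parts termwise; as \<open>\<nabla>\<^sub>S f\<close> is tangential, the normal part of the ambient gradient drops out.\<close>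

lemma integral_heat_gradient_sums:
  assumes f: "C1_on_sphere f" and t: "0 < t"
  shows "(\<lambda>d. exp (- (eigenvalue DIM('a) d * t)) * (eigenvalue DIM('a) d * sphere_inner f (gc d))) sums
    (LINT x|sphere_measure. spherical_gradient f x \<bullet> spherical_gradient (heat_semigroup t g) x)"
proof -
  let ?a = "\<lambda>d x. spherical_gradient f x \<bullet> (exp (- (eigenvalue DIM('a) d * t)) *\<^sub>R gradient (gc d) x)"
  note cont = C1_on_sphere_gradient_continuous_on[OF f]
  obtain C where C: "\<And>x. norm x = 1 \<Longrightarrow> \<bar>norm (spherical_gradient f x)\<bar> \<le> C"
    using continuous_on_sphere_bounded[OF continuous_on_norm[OF cont]] by blast
  have bound: "norm (?a d x) \<le> C * heat_bound t d" if "norm x = 1" for d x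
  proof -
    have "norm (?a d x) \<le> norm (spherical_gradient f x) * norm (exp (- (eigenvalue DIM('a) d * t)) *\<^sub>R gradient (gc d) x)"
      unfolding real_norm_def by (rule Cauchy_Schwarz_ineq2)
    also have "\<dots> \<le> C * heat_bound t d"
      using C[OF that] that by (intro mult_mono heat_gradient_bound) (auto intro: order_trans[OF norm_ge_zero])
    finally show ?thesis .
  qed
  have cont_a: "cont_sphere (?a d)" for d
    by (intro continuous_intros cont polynomial_gradient_continuous_on gc_polynomial)
  have sum: "summable (\<lambda>d. C * heat_bound t d)"
    by (intro summable_mult summable_heat_gradient_bound t)
  have "(\<lambda>d. LINT x|sphere_measure. ?a d x) sums (LINT x|sphere_measure. (\<Sum>d. ?a d x))"
  proof (rule sums_integral)
    show "integrable sphere_measure (?a d)" for d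
      by (rule continuous_on_sphere_integrable[OF cont_a])
    show "AE x in sphere_measure. summable (\<lambda>d. norm (?a d x))"
      by (rule AE_I2, rule summable_comparison_test'[OF sum, of 0]) (use bound in auto)
    have "(LINT x|sphere_measure. norm (?a d x)) \<le> (LINT x|(sphere_measure :: 'a measure). C * heat_bound t d)" for d
    proof (rule integral_mono)
      show "integrable sphere_measure (\<lambda>x. norm (?a d x))"
        by (intro integrable_norm continuous_on_sphere_integrable cont_a)
      show "integrable (sphere_measure :: 'a measure) (\<lambda>x. C * heat_bound t d)"
        by (intro continuous_on_sphere_integrable continuous_on_const)
      show "norm (?a d x) \<le> C * heat_bound t d" if "x \<in> space sphere_measure" for x
        by (rule bound) (use that in simp)
    qed
    then show "summable (\<lambda>d. LINT x|sphere_measure. norm (?a d x))"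
      by (intro summable_comparison_test'[OF sum, of 0]) (simp add: abs_of_nonneg)
  qed
  moreover have "(LINT x|sphere_measure. ?a d x) = exp (- (eigenvalue DIM('a) d * t)) * (eigenvalue DIM('a) d * sphere_inner f (gc d))" for d
    using integral_spherical_gradient_harmonic[OF f gc, of d]
    by (simp add: sphere_inner_def)
  moreover have "(LINT x|sphere_measure. (\<Sum>d. ?a d x)) =
      (LINT x|sphere_measure. spherical_gradient f x \<bullet> spherical_gradient (heat_semigroup t g) x)"
  proof (intro Bochner_Integration.integral_cong refl)
    fix x :: 'a
    assume "x \<in> space sphere_measure"
    then have x: "norm x = 1" by simp
    have "(heat_semigroup t g has_derivative (\<lambda>h. heat_gradient t x \<bullet> h)) (at x)"
      by (rule heat_semigroup_has_derivative[OF t]) (simp add: x)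
    then have "spherical_gradient (heat_semigroup t g) x = heat_gradient t x - (heat_gradient t x \<bullet> x) *\<^sub>R x"
      by (rule spherical_gradient_eq[OF has_derivative_at_withinI x])
    then have "spherical_gradient f x \<bullet> spherical_gradient (heat_semigroup t g) x = spherical_gradient f x \<bullet> heat_gradient t x"
      using C1_on_sphere_has_derivative(2)[OF f x] by (simp add: inner_diff_right)
    also have "\<dots> = (\<Sum>d. ?a d x)"
    proof -
      have "summable (\<lambda>d. norm (exp (- (eigenvalue DIM('a) d * t)) *\<^sub>R gradient (gc d) x))"
        by (rule summable_comparison_test'[OF summable_heat_gradient_bound[OF t], of 0])
           (use heat_gradient_bound[of x] x in auto)
      from bounded_linear.suminf[OF bounded_linear_inner_right summable_norm_cancel[OF this]]
      show ?thesis unfolding heat_gradient_def .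
    qed
    finally show "(\<Sum>d. ?a d x) = spherical_gradient f x \<bullet> spherical_gradient (heat_semigroup t g) x" by simp
  qed
  ultimately show ?thesis by simp
qed

lemma harmonic_component_0: "gc 0 x = (LINT x|sphere_measure. g x)"
proof -
  have const: "gc 0 x = gc 0 0" for x
    using gc[of 0] homogeneousD[of 0 "gc 0" 0 x] by (simp add: spherical_harmonics_iff)
  have one: "(\<lambda>x::'a. 1) \<in> spherical_harmonics 0"
    by (auto simp: spherical_harmonics_iff homogeneous_def laplacian_def intro: real_polynomial_function.intros(2))
  have "(LINT x|sphere_measure. gc 0 x) = (LINT x|sphere_measure. g x)"
    using harmonic_component_inner[OF dim g one] by (simp add: sphere_inner_def)
  moreover have "(LINT x|sphere_measure. gc 0 x) = (LINT x|(sphere_measure :: 'a measure). gc 0 0)"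
    by (intro Bochner_Integration.integral_cong refl const)
  ultimately show ?thesis using const[of x] by simp
qed

section \<open>The covariance formula\<close>

text \<open>
  Each \<open>k d\<close> below integrates to the coefficient \<open>a d\<close> when \<open>d > 0\<close>, and dominated convergence for series applies
  since \<open>\<Sum> |a d|\<close> converges. At \<open>t = 0\<close> the series need not represent the integrand, but a single point is negligible.
\<close>

lemma covariance_heat_semigroup:
  fixes f :: "'a \<Rightarrow> real"
  assumes f: "C1_on_sphere f"
  defines "I \<equiv> (\<lambda>t. LINT x|sphere_measure. spherical_gradient f x \<bullet> spherical_gradient (heat_semigroup t g) x)"
  shows "set_integrable lborel {0..} I" and "(LBINT t:{0..}. I t) = covariance sphere_measure f g"
proof -
  note cf = C1_on_sphere_continuous_on[OF f]
  define a where "a d = sphere_inner f (gc d)" for d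
  define k where "k d t = (indicator {0..} t * (eigenvalue DIM('a) d * exp (- (eigenvalue DIM('a) d * t)))) * a d" for d t
  have ev_pos: "0 < eigenvalue DIM('a) d" if "d \<noteq> 0" for d
    using that dim by (intro mult_pos_pos) auto
  have ev_nonneg: "0 \<le> eigenvalue DIM('a) d" for d
    using ev_pos[of d] by (cases "d = 0") auto
  have k_int: "has_bochner_integral lborel (k d) (if d = 0 then 0 else a d)" for d
  proof (cases "d = 0")
    case True
    then show ?thesis by (simp add: k_def[abs_def] has_bochner_integral_zero)
  next
    case False
    then show ?thesis
      using has_bochner_integral_mult_left[OF has_bochner_integral_exponential[OF ev_pos[OF False]], of "a d"]
      by (simp add: k_def[abs_def])
  qed
  have k_norm: "norm (k d t) =
      (indicator {0..} t * (eigenvalue DIM('a) d * exp (- (eigenvalue DIM('a) d * t)))) * \<bar>a d\<bar>" for d t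
  proof -
    have "0 \<le> indicator {0..} t * (eigenvalue DIM('a) d * exp (- (eigenvalue DIM('a) d * t)))"
      by (intro mult_nonneg_nonneg ev_nonneg) auto
    then show ?thesis
      unfolding k_def real_norm_def abs_mult[of _ "a d"] by (simp only: abs_of_nonneg)
  qed
  have k_abs_int: "(LINT t|lborel. norm (k d t)) = (if d = 0 then 0 else \<bar>a d\<bar>)" for d
  proof (cases "d = 0")
    case True
    then show ?thesis by (simp add: k_def)
  next
    case False
    then show ?thesis
      unfolding k_norm has_bochner_integral_integral_eq[OF
          has_bochner_integral_mult_left[OF has_bochner_integral_exponential[OF ev_pos[OF False]], of "\<bar>a d\<bar>"]]
      by simp
  qed
  have a_abs: "summable (\<lambda>d. \<bar>a d\<bar>)"
    unfolding a_def by (rule harmonic_component_abs_summable[OF dim g cf])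
  have k_summable: "summable (\<lambda>d. norm (k d t))" if "t \<noteq> 0" for t
  proof (cases "t < 0")
    case True
    then show ?thesis by (simp add: k_def)
  next
    case False
    with that have t: "t > 0" by simp
    show ?thesis
      \<comment> \<open>since \<open>l exp (- l t) \<le> 1 / t\<close> whatever \<open>l\<close>\<close>
    proof (rule summable_comparison_test'[OF summable_mult[OF a_abs, of "1 / t"], of 0])
      fix d
      have "l * exp (- (l * t)) \<le> 1 / t" for l
      proof -
        have "l * t \<le> exp (l * t)"
          using exp_ge_add_one_self[of "l * t"] by linarith
        then show ?thesis using t by (simp add: exp_minus field_simps)
      qed
      then have "eigenvalue DIM('a) d * exp (- (eigenvalue DIM('a) d * t)) * \<bar>a d\<bar> \<le> 1 / t * \<bar>a d\<bar>"
        by (rule mult_right_mono) simp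
      then have "norm (k d t) \<le> 1 / t * \<bar>a d\<bar>"
        unfolding k_norm using t by simp
      then show "norm (norm (k d t)) \<le> 1 / t * \<bar>a d\<bar>"
        by simp
    qed
  qed
  have AE_summable: "AE t in lborel. summable (\<lambda>d. norm (k d t))"
    by (rule AE_mp[OF AE_lborel_singleton[of 0]]) (intro AE_I2 impI k_summable)
  have int_summable: "summable (\<lambda>d. LINT t|lborel. norm (k d t))"
    unfolding k_abs_int by (rule summable_comparison_test'[OF a_abs, of 0]) auto
  have k_integrable: "integrable lborel (k d)" for d
    using k_int by (rule integrable.intros)
  have S_integrable: "integrable lborel (\<lambda>t. \<Sum>d. k d t)"
    by (rule integrable_suminf[OF k_integrable AE_summable int_summable])
  have S_integral: "(\<lambda>d. LINT t|lborel. k d t) sums (LINT t|lborel. (\<Sum>d. k d t))"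
    by (rule sums_integral[OF k_integrable AE_summable int_summable])
  \<comment> \<open>The term of degree 0, which is absent from the integral, is the product of the two means.\<close>
  have "(\<lambda>d. a d - (if d = 0 then a 0 else 0)) sums (sphere_inner f g - a 0)"
    unfolding a_def
    by (intro sums_diff harmonic_component_sums[OF dim g cf] sums_single[where i = 0 and f = "\<lambda>_. sphere_inner f (gc 0)"])
  moreover have "a d - (if d = 0 then a 0 else 0) = (LINT t|lborel. k d t)" for d
    using has_bochner_integral_integral_eq[OF k_int[of d]] by simp
  ultimately have "(LINT t|lborel. (\<Sum>d. k d t)) = sphere_inner f g - a 0"
    using S_integral sums_unique2 by simp
  also have "\<dots> = covariance sphere_measure f g"
    by (simp add: covariance_def a_def sphere_inner_def harmonic_component_0)
  finally have S_cov: "(LINT t|lborel. (\<Sum>d. k d t)) = covariance sphere_measure f g" .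
  have I_eq: "indicator {0..} t *\<^sub>R I t = (if t = 0 then I 0 else (\<Sum>d. k d t))" for t
  proof -
    consider "t < 0" | "t = 0" | "t > 0" by linarith
    then show ?thesis
    proof cases
      case 3
      have "(\<lambda>d. k d t) sums I t"
        using integral_heat_gradient_sums[OF f 3] 3 by (simp add: I_def k_def a_def mult_ac)
      then show ?thesis using 3 by (simp add: sums_iff)
    qed (auto simp: k_def)
  qed
  have S_meas: "(\<lambda>t. \<Sum>d. k d t) \<in> borel_measurable lborel"
    using S_integrable by (rule borel_measurable_integrable)
  have AE_eq: "AE t in lborel. (\<Sum>d. k d t) = (if t = 0 then I 0 else (\<Sum>d. k d t))"
    by (rule AE_mp[OF AE_lborel_singleton[of 0]]) auto
  have meas: "(\<lambda>t. if t = 0 then I 0 else (\<Sum>d. k d t)) \<in> borel_measurable lborel"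
    using S_meas by measurable
  show "set_integrable lborel {0..} I"
    unfolding set_integrable_def I_eq
    using integrable_cong_AE[OF S_meas meas AE_eq] S_integrable by simp
  show "(LBINT t:{0..}. I t) = covariance sphere_measure f g"
    unfolding set_lebesgue_integral_def I_eq
    using integral_cong_AE[OF S_meas meas AE_eq] S_cov by simp
qed

end

theorem theorem1p2:
  fixes f g :: "real ^ 'n \<Rightarrow> real"
  assumes "CARD('n) \<ge> 3"
    and "C1_on_sphere f" and "C1_on_sphere g"
  shows "(\<forall>t\<ge>0. integrable sphere_measure
            (\<lambda>x. spherical_gradient f x \<bullet> spherical_gradient (heat_semigroup t g) x)) \<and>
         set_integrable lborel {0..}
            (\<lambda>t. LINT x|sphere_measure.
                   spherical_gradient f x \<bullet> spherical_gradient (heat_semigroup t g) x) \<and>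
         covariance sphere_measure f g =
           (LBINT t:{0..}. LINT x|sphere_measure.
              spherical_gradient f x \<bullet> spherical_gradient (heat_semigroup t g) x)"
proof -
  have dim: "2 \<le> DIM(real ^ 'n)"
    using assms(1) by simp
  note cont_g = C1_on_sphere_continuous_on[OF assms(3)]
  have "C1_on_sphere (heat_semigroup t g)" if "t \<ge> 0" for t
  proof (cases "t = 0")
    case True
    then have "heat_semigroup t g = g" by (simp add: heat_semigroup_def fun_eq_iff)
    then show ?thesis using assms(3) by simp
  next
    case False
    then show ?thesis using that heat_semigroup_C1[OF dim cont_g] by simp
  qed
  then have "integrable sphere_measure
      (\<lambda>x. spherical_gradient f x \<bullet> spherical_gradient (heat_semigroup t g) x)" if "t \<ge> 0" for t
    using that assms(2)
    by (intro continuous_on_sphere_integrable continuous_on_inner C1_on_sphere_gradient_continuous_on)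
  then show ?thesis
    using covariance_heat_semigroup[OF dim cont_g assms(2)] by simp
qed

end
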